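(* Let $G$ be a finite simple connected graph with $n$ vertices that is not a tree, with a designated sink vertex, and let $d_*$ be the second-highest vertex degree in $G$. Let $H_{id}^t$ and $P_{id}^t$ denote the distributions at time $t$ of the continuous and discrete time sandpile chains on $G$, started from the identity of the sandpile group, and let $U$ be the uniform distribution on the sandpile group. For any $\varepsilon>0$, $$\max\left\{\|H_{id}^t-U\|_2^2,\ \|P_{id}^t-U\|_2^2\right\}\le\varepsilon\quad\text{for all } t\ge\frac1{16}(d_*^2+d_* )\,n\log\!\big[2(n-1)(1+1/\varepsilon)\big].$$
   Context: "Second-highest degree": if the degree sequence is $d_1\le\cdots\le d_{n-1}\le d_n$ then $d_*=d_{n-1}$. $\log$ is the natural logarithm. Sandpile chain on $G=(V,E)$ with sink $s$: a configuration is $\eta:V\setminus\{s\}\to\mathbb{N}$. It is stable if $\eta(v)<\deg(v)$ for all $v\ne s$. A vertex $v\neq s$ with $\eta(v)\ge\deg(v)$ may topple, losing $\deg(v)$ chips and giving one to each neighbor (chips sent to $s$ vanish). Toppling unstable vertices until none remain gives a stable configuration $\eta^\circ$ independent of the order. Put $\eta\oplus\sigma=(\eta+\sigma)^\circ$ on stable configurations. With $\eta_*(v)=\deg(v)-1$, the sandpile group $\mathcal{G}$ is the set of all (recurrent) configurations of the form $\eta_*\oplus\sigma$ with $\sigma$ stable; it is a finite abelian group under $\oplus$, with identity $id$. The discrete time sandpile chain on $\mathcal{G}$ moves from $\eta$ to $(\eta+\delta_v)^\circ$ with $v$ uniform in $V$ (all $n$ vertices), where $\delta_v(u)=1\{u=v\}$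 and $\delta_s\equiv0$; let $P$ be its transition matrix and $P^t_{id}=P^t(id,\cdot)$ (for integer $t$). The continuous time chain has kernel $H^t=e^{-t(I-P)}$, and $H^t_{id}=H^t(id,\cdot)$ (for real $t\geq 0$). $L^2$ distance: $\|\mu-\nu\|_2=\big(|\mathcal{G}|\sum_{g\in\mathcal{G}}|\mu(g)-\nu(g)|^2\big)^{1/2}$. *)

theory Defs
  imports Complex_Main "HOL-Library.Multiset" "Graph_Theory.Graph_Theory"
begin

section \<open>Simple graphs\<close>

text \<open>
  A finite simple graph is a \<open>pair_graph\<close>: a finite, loop-free, symmetric set of pairs, each
  edge being represented by its two orientations. The out-degree is then the degree.
\<close>

definition deg :: "'v pair_pre_digraph \<Rightarrow> 'v \<Rightarrow> nat" where
  "deg G v = out_degree (with_proj G) v"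

text \<open>
  \<open>Digraph_Component.tree\<close> is unsuitable here, since in a symmetric digraph it counts the closed
  walk \<open>a, b, a\<close> along a single edge as a cycle. The cycles of a simple graph are those of length
  at least 3.
\<close>

definition is_tree :: "'v pair_pre_digraph \<Rightarrow> bool" where
  "is_tree G \<longleftrightarrow> Digraph_Component.connected (with_proj G) \<and>
     \<not> (\<exists>p. pre_digraph.cycle (with_proj G) p \<and> 3 \<le> length p)"

definition degree_sequence :: "'v pair_pre_digraph \<Rightarrow> nat list" where
  "degree_sequence G = sorted_list_of_multiset (image_mset (deg G) (mset_set (pverts G)))"

text \<open>\<open>d\<^sub>* = d\<^bsub>n-1\<^esub>\<close> of the nondecreasing degree sequence; list positions start at 0.
  Meaningful for graphs with at least two vertices.\<close>

definition second_degree :: "'v pair_pre_digraph \<Rightarrow> nat" where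
  "second_degree G = degree_sequence G ! (card (pverts G) - 2)"

section \<open>Sandpiles\<close>

text \<open>Configurations on \<open>V - {s}\<close> are total functions vanishing off \<open>V - {s}\<close>, so that equality of
  functions is equality of configurations.\<close>

definition configs :: "'v pair_pre_digraph \<Rightarrow> 'v \<Rightarrow> ('v \<Rightarrow> nat) set" where
  "configs G s = {\<eta>. \<forall>v. v \<notin> pverts G - {s} \<longrightarrow> \<eta> v = 0}"

definition stable :: "'v pair_pre_digraph \<Rightarrow> 'v \<Rightarrow> ('v \<Rightarrow> nat) \<Rightarrow> bool" where
  "stable G s \<eta> \<longleftrightarrow> (\<forall>v \<in> pverts G - {s}. \<eta> v < deg G v)"

definition topple :: "'v pair_pre_digraph \<Rightarrow> 'v \<Rightarrow> 'v \<Rightarrow> ('v \<Rightarrow> nat) \<Rightarrow> ('v \<Rightarrow> nat)" where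
  "topple G s v \<eta> =
     (\<lambda>u. if u = v then \<eta> u - deg G v
          else if u \<noteq> s \<and> (v, u) \<in> parcs G then \<eta> u + 1
          else \<eta> u)"

definition topple_step ::
  "'v pair_pre_digraph \<Rightarrow> 'v \<Rightarrow> ('v \<Rightarrow> nat) \<Rightarrow> ('v \<Rightarrow> nat) \<Rightarrow> bool" where
  "topple_step G s \<eta> \<zeta> \<longleftrightarrow>
     (\<exists>v \<in> pverts G - {s}. deg G v \<le> \<eta> v \<and> \<zeta> = topple G s v \<eta>)"

definition stabilize :: "'v pair_pre_digraph \<Rightarrow> 'v \<Rightarrow> ('v \<Rightarrow> nat) \<Rightarrow> ('v \<Rightarrow> nat)" where
  "stabilize G s \<eta> = (THE \<zeta>. (topple_step G s)\<^sup>*\<^sup>* \<eta> \<zeta> \<and> stable G s \<zeta>)"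

definition sandpile_add ::
  "'v pair_pre_digraph \<Rightarrow> 'v \<Rightarrow> ('v \<Rightarrow> nat) \<Rightarrow> ('v \<Rightarrow> nat) \<Rightarrow> ('v \<Rightarrow> nat)" where
  "sandpile_add G s \<eta> \<sigma> = stabilize G s (\<lambda>v. \<eta> v + \<sigma> v)"

definition max_stable :: "'v pair_pre_digraph \<Rightarrow> 'v \<Rightarrow> ('v \<Rightarrow> nat)" where
  "max_stable G s = (\<lambda>v. if v \<in> pverts G - {s} then deg G v - 1 else 0)"

definition sandpile_group :: "'v pair_pre_digraph \<Rightarrow> 'v \<Rightarrow> ('v \<Rightarrow> nat) set" where
  "sandpile_group G s =
     {sandpile_add G s (max_stable G s) \<sigma> | \<sigma>. \<sigma> \<in> configs G s \<and> stable G s \<sigma>}"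

definition sandpile_id :: "'v pair_pre_digraph \<Rightarrow> 'v \<Rightarrow> ('v \<Rightarrow> nat)" where
  "sandpile_id G s = (THE e. e \<in> sandpile_group G s \<and>
     (\<forall>g \<in> sandpile_group G s. sandpile_add G s e g = g \<and> sandpile_add G s g e = g))"

section \<open>Kernels on a finite set\<close>

text \<open>Square matrices with rows and columns indexed by \<open>S\<close>; only the entries in \<open>S \<times> S\<close> matter.\<close>

definition kernel_one :: "'a \<Rightarrow> 'a \<Rightarrow> real" where
  "kernel_one x y = (if x = y then 1 else 0)"

definition kernel_mult ::
  "'a set \<Rightarrow> ('a \<Rightarrow> 'a \<Rightarrow> real) \<Rightarrow> ('a \<Rightarrow> 'a \<Rightarrow> real) \<Rightarrow> 'a \<Rightarrow> 'a \<Rightarrow> real" where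
  "kernel_mult S A B x y = (\<Sum>z\<in>S. A x z * B z y)"

primrec kernel_power :: "'a set \<Rightarrow> ('a \<Rightarrow> 'a \<Rightarrow> real) \<Rightarrow> nat \<Rightarrow> 'a \<Rightarrow> 'a \<Rightarrow> real" where
  "kernel_power S A 0 = kernel_one"
| "kernel_power S A (Suc k) = kernel_mult S A (kernel_power S A k)"

definition kernel_exp :: "'a set \<Rightarrow> ('a \<Rightarrow> 'a \<Rightarrow> real) \<Rightarrow> 'a \<Rightarrow> 'a \<Rightarrow> real" where
  "kernel_exp S A x y = (\<Sum>k. kernel_power S A k x y / fact k)"

definition uniform_on :: "'a set \<Rightarrow> 'a \<Rightarrow> real" where
  "uniform_on S x = 1 / real (card S)"

definition L2_dist :: "'a set \<Rightarrow> ('a \<Rightarrow> real) \<Rightarrow> ('a \<Rightarrow> real) \<Rightarrow> real" where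
  "L2_dist S \<mu> \<nu> = sqrt (real (card S) * (\<Sum>g\<in>S. \<bar>\<mu> g - \<nu> g\<bar>\<^sup>2))"

section \<open>The sandpile chains\<close>

definition chip :: "'v \<Rightarrow> 'v \<Rightarrow> 'v \<Rightarrow> nat" where
  "chip s v = (\<lambda>u. if v \<noteq> s \<and> u = v then 1 else 0)"

text \<open>The added vertex is uniform on all of \<open>V\<close>, sink included.\<close>

definition sandpile_kernel ::
  "'v pair_pre_digraph \<Rightarrow> 'v \<Rightarrow> ('v \<Rightarrow> nat) \<Rightarrow> ('v \<Rightarrow> nat) \<Rightarrow> real" where
  "sandpile_kernel G s \<eta> \<zeta> =
     real (card {v \<in> pverts G. stabilize G s (\<lambda>u. \<eta> u + chip s v u) = \<zeta>}) / real (card (pverts G))"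

definition discrete_dist :: "'v pair_pre_digraph \<Rightarrow> 'v \<Rightarrow> nat \<Rightarrow> ('v \<Rightarrow> nat) \<Rightarrow> real" where
  "discrete_dist G s t =
     kernel_power (sandpile_group G s) (sandpile_kernel G s) t (sandpile_id G s)"

definition continuous_dist :: "'v pair_pre_digraph \<Rightarrow> 'v \<Rightarrow> real \<Rightarrow> ('v \<Rightarrow> nat) \<Rightarrow> real" where
  "continuous_dist G s t =
     kernel_exp (sandpile_group G s)
       (\<lambda>\<eta> \<zeta>. - t * (kernel_one \<eta> \<zeta> - sandpile_kernel G s \<eta> \<zeta>)) (sandpile_id G s)"

end

theory Submission
  imports Defs "HOL-Analysis.Convex" "HOL-Analysis.Infinite_Sum" "HOL-Library.Confluence"
    "HOL-Library.Function_Algebras"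
begin

text \<open>
  The sandpile group is \<open>\<int>\<^bsup>V - s\<^esup>\<close> modulo the image of the Laplacian \<open>\<Delta>\<close>, so its characters are
  \<open>g \<mapsto> exp (2 \<pi> i \<langle>\<Delta>\<^sup>-\<^sup>1 h, g\<rangle>)\<close> with \<open>h\<close> again in the group, and Plancherel turns both \<open>L\<^sup>2\<close> distances
  into sums over the nontrivial eigenvalues \<open>\<lambda>\<^sub>h\<close>. In both cases the summand is at most
  \<open>exp (- 2 t (1 - \<bar>\<lambda>\<^sub>h\<bar>))\<close>, and \<open>1 - \<bar>\<lambda>\<^sub>h\<bar> \<ge> 8 \<parallel>x\<^sub>h\<parallel>\<^sup>2 / n\<close> for distinct nonzero points \<open>x\<^sub>h\<close> of the lattice
  of vectors orthogonal to the constants whose full Laplacian is integral. This lattice is dual to the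
  one spanned by the rows of the Laplacian, and all rows but that of a vertex of maximal degree have
  squared length at most \<open>d\<^sub>*\<^sup>2 + d\<^sub>*\<close>. The Gaussian sum over the nonzero points of a lattice is
  estimated, as in the bound of Micciancio and Regev for the smoothing parameter, by cutting the
  lattice into slices along each of these \<open>n - 1\<close> rows: slice \<open>j\<close> along \<open>v\<close> carries at most
  \<open>exp (- a j\<^sup>2 / \<parallel>v\<parallel>\<^sup>2)\<close> times the mass of slice \<open>0\<close>.
\<close>

section \<open>Gaussian sums over lattices\<close>

text \<open>The constant 1/16 has two sources: 1 - cos (2 pi y) >= 8 y^2 for |y| <= 1/2 gives a
  factor 8, and squaring the modulus of an eigenvalue gives a factor 2. Hence the Gaussian parameter
  is a = 16 t / n. With d the second-highest degree, the mass off the hyperplane orthogonal to one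
  of the n - 1 rows is at most a share 2 exp (- a / (d^2 + d)) of the total. If these shares add up
  to at most delta < 1, the mass off the origin is at most delta / (1 - delta), and the logarithm in
  the threshold is the one that makes this equal to epsilon. A row of maximal degree can be left out
  because the rows of the Laplacian sum to zero. On the algebraic side the group is given only
  through toppling. Everything rests on one fact: each integer class modulo the reduced Laplacian
  contains exactly one recurrent configuration. Finiteness of the group then makes the reduced
  Laplacian invertible over the reals without determinants, which provides the potentials that
  define the characters.\<close>

lemma
  fixes f :: "'a \<Rightarrow> real" and g :: "'b \<Rightarrow> real"
  assumes f: "f summable_on A" "\<And>x. x \<in> A \<Longrightarrow> f x \<ge> 0"
    and g: "g summable_on B" "\<And>x. x \<in> B \<Longrightarrow> g x \<ge> 0"
  shows summable_on_times: "(\<lambda>(x, y). f x * g y) summable_on A \<times> B"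
    and infsum_times: "infsum f A * infsum g B = infsum (\<lambda>(x, y). f x * g y) (A \<times> B)"
proof -
  show *: "(\<lambda>(x, y). f x * g y) summable_on A \<times> B"
  proof (rule summable_on_SigmaI)
    show "((\<lambda>y. case (x, y) of (x, y) \<Rightarrow> f x * g y) has_sum f x * infsum g B) B" if "x \<in> A" for x
      using has_sum_cmult_right[OF has_sum_infsum[OF g(1)]] by simp
    show "(\<lambda>x. f x * infsum g B) summable_on A"
      using f(1) by (rule summable_on_cmult_left)
  qed (use f g in auto)
  show "infsum f A * infsum g B = infsum (\<lambda>(x, y). f x * g y) (A \<times> B)"
    using infsum_Sigma'_banach[OF *] by (simp add: infsum_cmult_left' infsum_cmult_right')
qed

text \<open>Majorant for the slices off the origin: |j| <= j^2 turns Gaussian decay in j into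
  geometric decay. The positive and the negative indices contribute y / (1 - y) each.\<close>

lemma power_abs_int_has_sum:
  fixes y :: real
  assumes "0 \<le> y" "y < 1"
  shows "((\<lambda>j::int. y ^ nat \<bar>j\<bar>) has_sum 2 * y / (1 - y)) (UNIV - {0})"
proof -
  have "(\<lambda>k. y ^ k) sums (1 / (1 - y))"
    using assms by (intro geometric_sums) auto
  then have "(\<lambda>k. y * y ^ k) sums (y * (1 / (1 - y)))"
    by (rule sums_mult)
  then have S: "((\<lambda>k. y * y ^ k) has_sum y / (1 - y)) UNIV"
    using assms by (intro norm_summable_imp_has_sum) (auto simp: sums_iff)
  have "((\<lambda>j::int. y ^ nat \<bar>j\<bar>) has_sum y / (1 - y)) {0<..}"
    by (rule has_sum_reindex_bij_witness[where i = "\<lambda>j. nat (j - 1)" and j = "\<lambda>k. int k + 1", THEN iffD1, OF _ _ _ _ _ _ S])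
      (auto simp: nat_add_distrib power_add)
  moreover have "((\<lambda>j::int. y ^ nat \<bar>j\<bar>) has_sum y / (1 - y)) {..<0}"
    by (rule has_sum_reindex_bij_witness[where i = "\<lambda>j. nat (- j - 1)" and j = "\<lambda>k. - int k - 1", THEN iffD1, OF _ _ _ _ _ _ S])
      (auto simp: nat_add_distrib power_add)
  ultimately have "((\<lambda>j::int. y ^ nat \<bar>j\<bar>) has_sum (y / (1 - y) + y / (1 - y))) ({0<..} \<union> {..<0})"
    by (rule has_sum_Un_disjoint) auto
  also have "{0<..} \<union> {..<0} = UNIV - {0::int}" by auto
  finally show ?thesis by simp
qed

text \<open>The form is constrained on \<open>A\<close> only and no ambient vector space is fixed,
  so \<open>A\<close> may consist of functions. Convergence of all Gaussian sums takes the place of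
  discreteness.\<close>

locale gaussian_lattice =
  fixes A :: "'a::ab_group_add set" and B :: "'a \<Rightarrow> 'a \<Rightarrow> real"
  assumes zero_mem: "0 \<in> A"
    and diff_mem: "x \<in> A \<Longrightarrow> y \<in> A \<Longrightarrow> x - y \<in> A"
    and form_add: "x \<in> A \<Longrightarrow> y \<in> A \<Longrightarrow> z \<in> A \<Longrightarrow> B (x + y) z = B x z + B y z"
    and form_sym: "x \<in> A \<Longrightarrow> y \<in> A \<Longrightarrow> B x y = B y x"
    and form_pos: "x \<in> A \<Longrightarrow> x \<noteq> 0 \<Longrightarrow> B x x > 0"
    and gauss_summable: "a > 0 \<Longrightarrow> (\<lambda>x. exp (- a * B x x)) summable_on A"
begin

lemma add_mem: "x \<in> A \<Longrightarrow> y \<in> A \<Longrightarrow> x + y \<in> A"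
  using diff_mem[of x "0 - y"] diff_mem[OF zero_mem, of y] by simp

lemma form_diff: "x \<in> A \<Longrightarrow> y \<in> A \<Longrightarrow> z \<in> A \<Longrightarrow> B (x - y) z = B x z - B y z"
  using form_add[of "x - y" y z] diff_mem[of x y] by simp

lemma form_add_right: "x \<in> A \<Longrightarrow> y \<in> A \<Longrightarrow> z \<in> A \<Longrightarrow> B z (x + y) = B z x + B z y"
  using form_add[of x y z] form_sym[of z] add_mem by simp

lemma form_diff_right: "x \<in> A \<Longrightarrow> y \<in> A \<Longrightarrow> z \<in> A \<Longrightarrow> B z (x - y) = B z x - B z y"
  using form_diff[of x y z] form_sym[of z] diff_mem by simp

text \<open>Positivity excludes 2-torsion, since 2 B x x = B (x + x) x. This makes the map (x, y) to
  (x + y, x - y) injective.\<close>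

lemma double_eq_0: "x \<in> A \<Longrightarrow> x + x = 0 \<Longrightarrow> x = 0"
  using form_add[of x x x] form_diff[of 0 0 x] form_pos[of x] zero_mem by fastforce

lemma gauss_summable': "a > 0 \<Longrightarrow> C \<subseteq> A \<Longrightarrow> (\<lambda>x. exp (- a * B x x)) summable_on C"
  using gauss_summable summable_on_subset by blast

text \<open>Rotation invariance of the Gaussian: B (x + y) (x + y) + B (x - y) (x - y) is twice B x
  x + B y y, which is why the parameter is halved.\<close>

lemma parallelogram:
  assumes "x \<in> A" "y \<in> A"
  shows "exp (- a * B x x) * exp (- a * B y y) =
    exp (- (a / 2) * B (x + y) (x + y)) * exp (- (a / 2) * B (x - y) (x - y))"
proof -
  have p: "B (x + y) (x + y) = B x x + 2 * B x y + B y y"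
    using assms by (simp add: form_add form_add_right form_sym[of y x] add_mem)
  have m: "B (x - y) (x - y) = B x x - 2 * B x y + B y y"
    using assms by (simp add: form_diff form_diff_right form_sym[of y x] diff_mem)
  show ?thesis
    unfolding p m exp_add[symmetric] by (simp add: field_simps)
qed

section \<open>Slices of a lattice and congruence modulo 2A\<close>

definition slice :: "'a \<Rightarrow> int \<Rightarrow> 'a set" where
  "slice v j = {x \<in> A. B x v = of_int j}"

definition slice_sum :: "'a \<Rightarrow> real \<Rightarrow> int \<Rightarrow> real" where
  "slice_sum v a j = infsum (\<lambda>x. exp (- a * B x x)) (slice v j)"

text \<open>The class of a lattice point in A / 2A, taken as a set so that classes can serve as
  summation indices.\<close>

definition coset2 :: "'a \<Rightarrow> 'a set" where
  "coset2 x = {y \<in> A. \<exists>z\<in>A. x - y = z + z}"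

definition twin_sum :: "'a \<Rightarrow> real \<Rightarrow> int \<Rightarrow> int \<Rightarrow> real" where
  "twin_sum v a j k = infsum (\<lambda>(p, r). exp (- (a / 2) * B p p) * exp (- (a / 2) * B r r))
     {(p, r) \<in> slice v j \<times> slice v k. coset2 p = coset2 r}"

lemma slice_subset: "slice v j \<subseteq> A"
  by (auto simp: slice_def)

lemma coset2_eq_iff:
  assumes "p \<in> A" "r \<in> A"
  shows "coset2 p = coset2 r \<longleftrightarrow> (\<exists>z\<in>A. p - r = z + z)"
proof
  assume "coset2 p = coset2 r"
  moreover have "r \<in> coset2 r" using assms zero_mem by (auto simp: coset2_def intro!: bexI[of _ 0])
  ultimately have "r \<in> coset2 p" by simp
  then show "\<exists>z\<in>A. p - r = z + z" by (simp add: coset2_def)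
next
  assume "\<exists>z\<in>A. p - r = z + z"
  then obtain z where z: "z \<in> A" "p - r = z + z" by blast
  have "(\<exists>u\<in>A. p - y = u + u) \<longleftrightarrow> (\<exists>u\<in>A. r - y = u + u)" for y
  proof
    assume "\<exists>u\<in>A. p - y = u + u"
    then obtain u where u: "u \<in> A" "p - y = u + u" by blast
    have "r - y = (p - y) - (p - r)" by simp
    also have "\<dots> = (u - z) + (u - z)" unfolding u z by (simp add: algebra_simps)
    finally show "\<exists>u\<in>A. r - y = u + u" using u z diff_mem by blast
  next
    assume "\<exists>u\<in>A. r - y = u + u"
    then obtain u where u: "u \<in> A" "r - y = u + u" by blast
    have "p - y = (r - y) + (p - r)" by simp
    also have "\<dots> = (u + z) + (u + z)" unfolding u z by (simp add: algebra_simps)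
    finally show "\<exists>u\<in>A. p - y = u + u" using u z add_mem by blast
  qed
  then show "coset2 p = coset2 r" by (auto simp: coset2_def)
qed

text \<open>The rotation \<open>(x, y) \<mapsto> (x + y, x - y)\<close> maps pairs of lattice points onto the pairs of points
  that agree modulo \<open>2A\<close>.\<close>

lemma slice_sum_times:
  assumes "v \<in> A" "a > 0"
  shows "slice_sum v a i * slice_sum v a j = twin_sum v a (i + j) (i - j)"
proof -
  let ?f = "\<lambda>x. exp (- a * B x x)" and ?h = "\<lambda>x. exp (- (a / 2) * B x x)"
  have bij: "bij_betw (\<lambda>(x, y). (x + y, x - y)) (slice v i \<times> slice v j)
      {(p, r) \<in> slice v (i + j) \<times> slice v (i - j). coset2 p = coset2 r}"
  proof (rule bij_betw_imageI)
    show "inj_on (\<lambda>(x, y). (x + y, x - y)) (slice v i \<times> slice v j)"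
    proof (rule inj_onI, clarify)
      fix x y x' y'
      assume m: "x \<in> slice v i" "y \<in> slice v j" "x' \<in> slice v i" "y' \<in> slice v j"
        and e: "x + y = x' + y'" "x - y = x' - y'"
      have "(x - x') + (x - x') = (x + y) - (x' + y') + ((x - y) - (x' - y'))"
        by (simp add: algebra_simps)
      then have "x = x'" using e m double_eq_0[of "x - x'"] diff_mem by (auto simp: slice_def)
      then show "x = x' \<and> y = y'" using e by simp
    qed
    show "(\<lambda>(x, y). (x + y, x - y)) ` (slice v i \<times> slice v j) =
        {(p, r) \<in> slice v (i + j) \<times> slice v (i - j). coset2 p = coset2 r}" (is "?L = ?R")
    proof (intro equalityI subsetI)
      fix w assume "w \<in> ?L"
      then obtain x y where w: "w = (x + y, x - y)" "x \<in> slice v i" "y \<in> slice v j" by auto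
      have "(x + y) - (x - y) = y + y" by simp
      then have "coset2 (x + y) = coset2 (x - y)"
        using w by (subst coset2_eq_iff) (auto simp: slice_def add_mem diff_mem)
      then show "w \<in> ?R"
        using w assms by (auto simp: slice_def add_mem diff_mem form_add form_diff)
    next
      fix w assume "w \<in> ?R"
      then obtain p r where w: "w = (p, r)" "p \<in> slice v (i + j)" "r \<in> slice v (i - j)"
        "coset2 p = coset2 r" by auto
      then obtain z where z: "z \<in> A" "p - r = z + z"
        using coset2_eq_iff slice_subset by blast
      \<comment> \<open>Congruence modulo 2A supplies half of p - r inside \<open>A\<close>, so the
        preimage is (p - z, z).\<close>
      have p: "p = (p - z) + z" and r: "r = (p - z) - z"
        using z by (auto simp: algebra_simps)
      have mem: "p \<in> A" "r \<in> A" "p - z \<in> A" using w z by (auto simp: slice_def diff_mem)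
      have "B p v - B r v = 2 * B z v"
        using form_diff[of p r v] form_add[of z z v] z mem assms by simp
      then have "B z v = of_int j" using w by (simp add: slice_def)
      moreover from this have "B (p - z) v = of_int i"
        using w mem z assms form_diff[of p z v] by (simp add: slice_def)
      ultimately have "(p - z, z) \<in> slice v i \<times> slice v j"
        using mem z by (simp add: slice_def)
      moreover have "w = (\<lambda>(x, y). (x + y, x - y)) (p - z, z)" using w p r by simp
      ultimately show "w \<in> ?L" by blast
    qed
  qed
  have "slice_sum v a i * slice_sum v a j =
      infsum (\<lambda>(x, y). ?f x * ?f y) (slice v i \<times> slice v j)"
    unfolding slice_sum_def using assms gauss_summable' slice_subset by (intro infsum_times) auto
  also have "\<dots> = infsum (\<lambda>w. (\<lambda>(p, r). ?h p * ?h r) (case w of (x, y) \<Rightarrow> (x + y, x - y)))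
      (slice v i \<times> slice v j)"
  proof (rule infsum_cong, clarify)
    fix x y assume "x \<in> slice v i" "y \<in> slice v j"
    then have "x \<in> A" "y \<in> A" using slice_subset by auto
    then show "?f x * ?f y = ?h (x + y) * ?h (x - y)" by (rule parallelogram)
  qed
  also have "\<dots> = twin_sum v a (i + j) (i - j)"
    unfolding twin_sum_def by (rule infsum_reindex_bij_betw[OF bij])
  finally show ?thesis .
qed

text \<open>Grouping the pairs by their common class exhibits \<open>twin_sum\<close> as an inner
  product, indexed by A / 2A, of a vector depending on j with one depending on k. Its entries thus
  form a Gram matrix.\<close>

lemma twin_sum_has_sum:
  assumes "v \<in> A" "a > 0"
  defines "g \<equiv> \<lambda>j K. infsum (\<lambda>x. exp (- (a / 2) * B x x)) {p \<in> slice v j. coset2 p = K}"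
  shows "((\<lambda>K. g j K * g k K) has_sum twin_sum v a j k) (coset2 ` A)"
proof -
  let ?h = "\<lambda>x. exp (- (a / 2) * B x x)"
  let ?C = "\<lambda>j K. {p \<in> slice v j. coset2 p = K}"
  let ?T = "{(p, r) \<in> slice v j \<times> slice v k. coset2 p = coset2 r}"
  let ?S = "Sigma (coset2 ` A) (\<lambda>K. ?C j K \<times> ?C k K)"
  have sub: "?C j K \<subseteq> A" for j K using slice_subset by auto
  have a2: "a / 2 > 0" using assms by simp
  have bij: "bij_betw snd ?S ?T"
    by (rule bij_betw_byWitness[where f' = "\<lambda>(p, r). (coset2 p, (p, r))"])
      (use slice_subset in auto)
  have "(\<lambda>(p, r). ?h p * ?h r) summable_on A \<times> A"
    using gauss_summable[OF a2] by (intro summable_on_times) auto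
  then have "(\<lambda>(p, r). ?h p * ?h r) summable_on ?T"
    by (rule summable_on_subset) (use slice_subset in auto)
  then have "(\<lambda>w. (\<lambda>(p, r). ?h p * ?h r) (snd w)) summable_on ?S"
    by (subst summable_on_reindex_bij_betw[OF bij])
  then have s: "(\<lambda>(K, w). (\<lambda>(p, r). ?h p * ?h r) w) summable_on ?S"
    by (simp add: case_prod_unfold)
  have g: "infsum (\<lambda>(p, r). ?h p * ?h r) (?C j K \<times> ?C k K) = g j K * g k K" for K
    unfolding g_def using gauss_summable'[OF a2 sub] by (intro infsum_times[symmetric]) auto
  have "infsum (\<lambda>K. g j K * g k K) (coset2 ` A) = infsum (\<lambda>(K, w). (\<lambda>(p, r). ?h p * ?h r) w) ?S"
    using infsum_Sigma'_banach[OF s] unfolding g .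
  also have "\<dots> = infsum (\<lambda>w. (\<lambda>(p, r). ?h p * ?h r) (snd w)) ?S"
    by (simp add: case_prod_unfold)
  also have "\<dots> = twin_sum v a j k"
    unfolding twin_sum_def by (rule infsum_reindex_bij_betw[OF bij])
  finally show ?thesis
    using has_sum_infsum[OF summable_on_Sigma_banach[OF s, unfolded g]] by simp
qed

text \<open>Cauchy-Schwarz for this Gram matrix in its weighted arithmetic-geometric form, applied
  class by class. The weight c stays free to balance the two diagonal entries.\<close>

lemma twin_sum_le:
  assumes "v \<in> A" "a > 0" "c > 0"
  shows "twin_sum v a j k \<le> (c * twin_sum v a j j + twin_sum v a k k / c) / 2"
proof -
  define g where "g = (\<lambda>j K. infsum (\<lambda>x. exp (- (a / 2) * B x x)) {p \<in> slice v j. coset2 p = K})"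
  have tw: "((\<lambda>K. g j K * g k K) has_sum twin_sum v a j k) (coset2 ` A)" for j k
    unfolding g_def by (rule twin_sum_has_sum[OF assms(1,2)])
  have mean: "((\<lambda>K. (c * (g j K * g j K) + g k K * g k K * inverse c) * (1 / 2)) has_sum
     (c * twin_sum v a j j + twin_sum v a k k * inverse c) * (1 / 2)) (coset2 ` A)"
    by (intro has_sum_cmult_left has_sum_add has_sum_cmult_right tw)
  have am_gm: "x * y \<le> (c * (x * x) + y * y * inverse c) * (1 / 2)" for x y :: real
  proof -
    have "0 \<le> (c * x - y)\<^sup>2 / c" using assms by simp
    also have "\<dots> = c * (x * x) - 2 * (x * y) + y * y * inverse c"
      using assms by (simp add: power2_eq_square field_simps)
    finally show ?thesis by simp
  qed
  have "twin_sum v a j k \<le> (c * twin_sum v a j j + twin_sum v a k k * inverse c) * (1 / 2)"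
    by (rule has_sum_mono[OF tw mean]) (rule am_gm)
  then show ?thesis using assms by (simp add: field_simps)
qed

lemma slice_sum_nonneg: "slice_sum v a j \<ge> 0"
  unfolding slice_sum_def by (rule infsum_nonneg) simp

lemma slice_sum_0_pos:
  assumes "v \<in> A" "a > 0"
  shows "slice_sum v a 0 > 0"
proof -
  have "(\<Sum>x\<in>{0}. exp (- a * B x x)) \<le> slice_sum v a 0"
    unfolding slice_sum_def using assms gauss_summable' slice_subset
    by (intro finite_sum_le_infsum) (auto simp: slice_def zero_mem form_diff[of 0 0 v, simplified])
  then show ?thesis using order_less_le_trans[OF exp_gt_zero[of "- a * B 0 0"]] by simp
qed

lemma form_add_self:
  assumes "x \<in> A" "v \<in> A"
  shows "B (x + v) (x + v) = B x x + 2 * B x v + B v v"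
  using assms by (simp add: form_add form_add_right form_sym[of v x] add_mem)

text \<open>Translation by v maps slice j onto slice j + N and raises B x x by 2 j + N, which is
  exactly (j + N)^2 / N - j^2 / N. The rescaled slice sums are therefore periodic with period
  N.\<close>

lemma slice_sum_shift:
  assumes "v \<in> A" "B v v = of_int N" "N > 0"
  shows "slice_sum v a (j + N) * exp (a * (of_int (j + N))\<^sup>2 / of_int N) =
    slice_sum v a j * exp (a * (of_int j)\<^sup>2 / of_int N)"
proof -
  have bij: "bij_betw (\<lambda>x. x + v) (slice v j) (slice v (j + N))"
    by (rule bij_betw_byWitness[where f' = "\<lambda>x. x - v"])
      (use assms in \<open>auto simp: slice_def add_mem diff_mem form_add form_diff\<close>)
  have "slice_sum v a (j + N) = infsum (\<lambda>x. exp (- a * B (x + v) (x + v))) (slice v j)"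
    unfolding slice_sum_def by (rule infsum_reindex_bij_betw[OF bij, symmetric])
  also have "\<dots> = infsum (\<lambda>x. exp (- a * B x x) * exp (- a * (2 * of_int j + of_int N))) (slice v j)"
    by (rule infsum_cong)
      (use assms in \<open>auto simp: slice_def form_add_self exp_add[symmetric] algebra_simps\<close>)
  also have "\<dots> = slice_sum v a j * exp (- a * (2 * of_int j + of_int N))"
    unfolding slice_sum_def by (rule infsum_cmult_left')
  finally have 1: "slice_sum v a (j + N) = slice_sum v a j * exp (- a * (2 * of_int j + of_int N))" .
  have "exp (- a * (2 * of_int j + of_int N)) * exp (a * (of_int (j + N))\<^sup>2 / of_int N) =
      exp (a * (of_int j)\<^sup>2 / of_int N)"
    using assms(3) by (simp add: exp_add[symmetric] power2_eq_square field_simps)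
  then show ?thesis unfolding 1 by simp
qed

text \<open>The rescaled slice sums \<open>r j\<close> satisfy \<open>(r j)\<^sup>2 \<le> (r (2 j) r 0 + (r 0)\<^sup>2) / 2\<close> and take only
  finitely many values, so the largest of them is \<open>r 0\<close>. This replaces Poisson summation.\<close>

lemma slice_sum_le:
  assumes v: "v \<in> A" "v \<noteq> 0" and int: "B v v \<in> \<int>" and a: "a > 0"
  shows "slice_sum v a j \<le> exp (- a * (of_int j)\<^sup>2 / B v v) * slice_sum v a 0"
proof -
  obtain N where N: "B v v = of_int N" using int by (elim Ints_cases)
  have Npos: "N > 0" using form_pos[OF v] N by simp
  define E where "E j = exp (a * (of_int j)\<^sup>2 / of_int N)" for j :: int
  define r where "r j = slice_sum v a j * E j" for j
  have E2: "E (2 * j) = E j ^ 4" for j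
    by (simp add: E_def exp_of_nat_mult[symmetric] power_mult_distrib)
  have r0: "r 0 = slice_sum v a 0" by (simp add: r_def E_def)
  have r0_pos: "r 0 > 0" using slice_sum_0_pos[OF v(1) a] r0 by simp
  have shift: "r (j + N) = r j" for j
    using slice_sum_shift[OF v(1) N Npos] by (simp add: r_def E_def)
  have shift': "r (j + int k * N) = r j" for j k
  proof (induction k)
    case (Suc k)
    have "j + int (Suc k) * N = (j + int k * N) + N" by (simp add: algebra_simps)
    then show ?case using Suc shift[of "j + int k * N"] by (simp add: add.assoc)
  qed simp
  have "r j = r (j mod N)" for j
  proof (cases "j \<ge> 0")
    case True
    then have "j mod N + int (nat (j div N)) * N = j"
      using Npos by (simp add: pos_imp_zdiv_nonneg_iff)
    then show ?thesis using shift'[of "j mod N" "nat (j div N)"] by simp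
  next
    case False
    then have "j div N \<le> 0" using Npos by (smt (verit) pos_imp_zdiv_nonneg_iff)
    then have "j mod N = j + int (nat (- (j div N))) * N"
      by (simp add: minus_div_mult_eq_mod[symmetric])
    then show ?thesis using shift'[of j "nat (- (j div N))"] by simp
  qed
  moreover have "j mod N \<in> {0..<N}" for j using Npos by simp
  ultimately have "range r \<subseteq> r ` {0..<N}" by (intro image_subsetI image_eqI)
  then have fin: "finite (range r)" by (rule finite_subset) simp
  have step: "(r j)\<^sup>2 \<le> (r (2 * j) * r 0 + (r 0)\<^sup>2) / 2" for j
  proof -
    have Epos: "E j > 0" by (simp add: E_def)
    have "(slice_sum v a j)\<^sup>2 = twin_sum v a (2 * j) 0"
      using slice_sum_times[OF v(1) a, of j j] by (simp add: power2_eq_square)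
    \<comment> \<open>The weight (E j)^2 is chosen so that, after multiplication by (E j)^2, the
      first term carries E j ^ 4 = E (2 * j) and the second carries no factor \<open>E\<close> at
      all.\<close>
    also have "\<dots> \<le> ((E j)\<^sup>2 * twin_sum v a (2 * j) (2 * j) + twin_sum v a 0 0 / (E j)\<^sup>2) / 2"
      using Epos by (intro twin_sum_le v a) simp
    also have "\<dots> = ((E j)\<^sup>2 * (slice_sum v a (2 * j) * slice_sum v a 0)
        + slice_sum v a 0 * slice_sum v a 0 / (E j)\<^sup>2) / 2"
      using slice_sum_times[OF v(1) a, of "2 * j" 0] slice_sum_times[OF v(1) a, of 0 0] by simp
    finally have "(slice_sum v a j)\<^sup>2 * (E j)\<^sup>2 \<le> ((E j)\<^sup>2 * (slice_sum v a (2 * j) * slice_sum v a 0)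
        + slice_sum v a 0 * slice_sum v a 0 / (E j)\<^sup>2) / 2 * (E j)\<^sup>2"
      using Epos by (intro mult_right_mono) auto
    also have "\<dots> = (E j ^ 4 * slice_sum v a (2 * j) * slice_sum v a 0 + (slice_sum v a 0)\<^sup>2) / 2"
      using Epos by (simp add: field_simps power2_eq_square power4_eq_xxxx)
    finally show ?thesis
      unfolding r0 unfolding r_def E2 by (simp add: power_mult_distrib mult_ac)
  qed
  define M where "M = Max (range r)"
  have M: "r j \<le> M" for j unfolding M_def using fin by simp
  obtain j0 where j0: "M = r j0"
    using Max_in[OF fin] unfolding M_def by auto
  \<comment> \<open>At a maximiser the doubling inequality becomes quadratic in M, and 2 M^2 - M r 0
    - (r 0)^2 = (M - r 0) (2 M + r 0).\<close>
  have "M\<^sup>2 \<le> (M * r 0 + (r 0)\<^sup>2) / 2"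
    using step[of j0] M[of "2 * j0"] r0_pos mult_right_mono[OF M[of "2 * j0"], of "r 0"]
    unfolding j0 by argo
  then have "(M - r 0) * (2 * M + r 0) \<le> 0" by (simp add: algebra_simps power2_eq_square)
  moreover have "2 * M + r 0 > 0" using M[of 0] r0_pos by simp
  ultimately have "M \<le> r 0" by (simp add: mult_le_0_iff)
  then have "slice_sum v a j * E j \<le> slice_sum v a 0" using M[of j] r0 unfolding r_def by simp
  moreover have "E j * exp (- a * (of_int j)\<^sup>2 / B v v) = 1"
    by (simp add: E_def N exp_add[symmetric])
  ultimately show ?thesis
    using mult_right_mono[of "slice_sum v a j * E j" "slice_sum v a 0" "exp (- a * (of_int j)\<^sup>2 / B v v)"]
    by (simp add: mult.assoc) (simp add: mult.commute)
qed

text \<open>The points off the hyperplane fill the slices with nonzero index, and slice j carries at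
  most y ^ |j| times the mass of slice 0.\<close>

lemma infsum_off_hyperplane_le:
  assumes v: "v \<in> A" "v \<noteq> 0" and int: "\<And>x. x \<in> A \<Longrightarrow> B x v \<in> \<int>" and a: "a > 0"
  defines "y \<equiv> exp (- a / B v v)"
  shows "infsum (\<lambda>x. exp (- a * B x x)) {x \<in> A. B x v \<noteq> 0} \<le>
    2 * y * infsum (\<lambda>x. exp (- a * B x x)) A"
proof -
  let ?f = "\<lambda>x. exp (- a * B x x)" and ?C = "{x \<in> A. B x v \<noteq> 0}"
  let ?S = "Sigma (UNIV - {0}) (slice v)"
  have D: "B v v > 0" using form_pos v by simp
  have y: "0 < y" "y < 1" using a D by (auto simp: y_def)
  have floor: "of_int \<lfloor>B x v\<rfloor> = B x v" if "x \<in> A" for x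
    using int[OF that] by (elim Ints_cases) simp
  have bij: "bij_betw snd ?S ?C"
  proof (rule bij_betw_byWitness[where f' = "\<lambda>x. (\<lfloor>B x v\<rfloor>, x)"])
    show "(\<lambda>x. (\<lfloor>B x v\<rfloor>, x)) ` ?C \<subseteq> ?S"
    proof clarify
      fix x assume x: "x \<in> A" "B x v \<noteq> 0"
      then have "\<lfloor>B x v\<rfloor> \<noteq> 0" using floor[of x] by force
      then show "\<lfloor>B x v\<rfloor> \<in> UNIV - {0} \<and> x \<in> slice v \<lfloor>B x v\<rfloor>"
        using x(1) floor[OF x(1), symmetric] unfolding slice_def by blast
    qed
  qed (auto simp: slice_def)
  have "?f summable_on ?C" using a by (intro gauss_summable') auto
  then have "(\<lambda>w. ?f (snd w)) summable_on ?S" by (subst summable_on_reindex_bij_betw[OF bij])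
  then have s: "(\<lambda>(j, x). ?f x) summable_on ?S" by (simp add: case_prod_unfold)
  have "infsum ?f ?C = infsum (\<lambda>w. ?f (snd w)) ?S"
    by (rule infsum_reindex_bij_betw[OF bij, symmetric])
  also have "\<dots> = infsum (slice_sum v a) (UNIV - {0})"
    using infsum_Sigma'_banach[OF s] by (simp add: slice_sum_def[abs_def] case_prod_unfold)
  also have "\<dots> \<le> 2 * y / (1 - y) * slice_sum v a 0"
  proof (rule has_sum_mono)
    show "(slice_sum v a has_sum infsum (slice_sum v a) (UNIV - {0})) (UNIV - {0})"
      using summable_on_Sigma_banach[OF s] unfolding slice_sum_def[abs_def] by simp
    show "((\<lambda>j. y ^ nat \<bar>j\<bar> * slice_sum v a 0) has_sum 2 * y / (1 - y) * slice_sum v a 0) (UNIV - {0})"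
      by (intro has_sum_cmult_left power_abs_int_has_sum) (use y in auto)
    fix j :: int
    have "\<bar>of_int j\<bar> \<le> (of_int j :: real)\<^sup>2"
      using self_le_power[of "\<bar>of_int j :: real\<bar>" 2] by (cases "j = 0") (auto simp flip: of_int_abs)
    then have "exp (- a * (of_int j)\<^sup>2 / B v v) \<le> exp (of_nat (nat \<bar>j\<bar>) * (- a / B v v))"
      using a D by (simp add: field_simps)
    also have "\<dots> = y ^ nat \<bar>j\<bar>" unfolding y_def by (rule exp_of_nat_mult)
    finally show "slice_sum v a j \<le> y ^ nat \<bar>j\<bar> * slice_sum v a 0"
      using slice_sum_le[OF v int[OF v(1)] a, of j] slice_sum_nonneg[of v a 0]
      by (meson mult_right_mono order_trans)
  qed
  finally have 1: "infsum ?f ?C \<le> 2 * y / (1 - y) * slice_sum v a 0" .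
  have "slice v 0 \<union> ?C = A" "slice v 0 \<inter> ?C = {}" by (auto simp: slice_def)
  then have 2: "infsum ?f A = slice_sum v a 0 + infsum ?f ?C"
    using infsum_Un_disjoint[OF gauss_summable'[OF a slice_subset] gauss_summable'[OF a, of ?C], of v 0]
    by (simp add: slice_sum_def)
  \<comment> \<open>Replacing slice 0 by the total mass minus the mass off the hyperplane turns the
    factor 2 y / (1 - y) into 2 y / (1 + y), hence into at most 2 y.\<close>
  have "infsum ?f ?C * (1 - y) \<le> 2 * y * slice_sum v a 0"
    using 1 y by (simp add: field_simps)
  then have "infsum ?f ?C * (1 + y) \<le> 2 * y * infsum ?f A"
    unfolding 2 by (simp add: algebra_simps)
  moreover have "infsum ?f ?C \<le> infsum ?f ?C * (1 + y)"
    using y infsum_nonneg[of ?C ?f] by (simp add: algebra_simps)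
  ultimately show ?thesis by simp
qed

text \<open>Union bound: by \<open>sep\<close> every nonzero point lies off one of the hyperplanes,
  and each hyperplane is missed by at most a share 2 X of the total mass.\<close>

lemma infsum_gauss_nonzero_le:
  assumes I: "finite I" "\<And>i. i \<in> I \<Longrightarrow> v i \<in> A" "\<And>i. i \<in> I \<Longrightarrow> v i \<noteq> 0"
    and int: "\<And>i x. i \<in> I \<Longrightarrow> x \<in> A \<Longrightarrow> B x (v i) \<in> \<int>"
    and sep: "\<And>x. x \<in> A \<Longrightarrow> x \<noteq> 0 \<Longrightarrow> \<exists>i\<in>I. B x (v i) \<noteq> 0"
    and a: "a > 0" and X: "\<And>i. i \<in> I \<Longrightarrow> exp (- a / B (v i) (v i)) \<le> X"
    and small: "2 * real (card I) * X < 1"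
  shows "infsum (\<lambda>x. exp (- a * B x x)) (A - {0}) \<le>
    2 * real (card I) * X / (1 - 2 * real (card I) * X)"
proof -
  let ?f = "\<lambda>x. exp (- a * B x x)" and ?C = "\<lambda>i. {x \<in> A. B x (v i) \<noteq> 0}"
  let ?N = "2 * real (card I) * X"
  have B0: "B 0 z = 0" if "z \<in> A" for z
    using form_diff[of 0 0 z] zero_mem that by simp
  have s: "?f summable_on C" if "C \<subseteq> A" for C using gauss_summable'[OF a that] .
  have union: "infsum ?f (\<Union>i\<in>J. ?C i) \<le> (\<Sum>i\<in>J. infsum ?f (?C i))" if "finite J" for J
    using that
  proof (induction J)
    case (insert i J)
    have "infsum ?f (\<Union>i\<in>insert i J. ?C i) = infsum ?f (?C i \<union> ((\<Union>i\<in>J. ?C i) - ?C i))"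
      by (rule arg_cong[of _ _ "infsum ?f"]) auto
    also have "\<dots> = infsum ?f (?C i) + infsum ?f ((\<Union>i\<in>J. ?C i) - ?C i)"
      by (intro infsum_Un_disjoint s) auto
    also have "infsum ?f ((\<Union>i\<in>J. ?C i) - ?C i) \<le> infsum ?f (\<Union>i\<in>J. ?C i)"
      by (intro infsum_mono2 s) auto
    finally show ?case using insert by simp
  qed simp
  have "A - {0} = (\<Union>i\<in>I. ?C i)" using sep I(2) B0 by auto
  then have "infsum ?f (A - {0}) \<le> (\<Sum>i\<in>I. infsum ?f (?C i))" using union[OF I(1)] by simp
  also have "\<dots> \<le> (\<Sum>i\<in>I. 2 * X * infsum ?f A)"
  proof (rule sum_mono)
    fix i assume i: "i \<in> I"
    have "infsum ?f (?C i) \<le> 2 * exp (- a / B (v i) (v i)) * infsum ?f A"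
      using infsum_off_hyperplane_le[OF I(2,3)[OF i] int[OF i] a] by simp
    also have "\<dots> \<le> 2 * X * infsum ?f A"
      using X[OF i] by (intro mult_right_mono infsum_nonneg) auto
    finally show "infsum ?f (?C i) \<le> 2 * X * infsum ?f A" .
  qed
  also have "\<dots> = ?N * infsum ?f A" by simp
  \<comment> \<open>The origin has mass 1, so S <= N (1 + S) for the mass S off the origin. This is
    solved for S using N < 1.\<close>
  also have "infsum ?f A = 1 + infsum ?f (A - {0})"
  proof -
    have "infsum ?f ({0} \<union> (A - {0})) = infsum ?f {0} + infsum ?f (A - {0})"
      by (intro infsum_Un_disjoint s) (use zero_mem in auto)
    moreover have "{0} \<union> (A - {0}) = A" using zero_mem by auto
    ultimately show ?thesis using B0[OF zero_mem] by simp
  qed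
  finally show ?thesis using small by (simp add: field_simps)
qed

end

section \<open>Sums of unit vectors and Gaussian sums over the integers\<close>

lemma real_family_bounded_by_nat:
  fixes f :: "'a \<Rightarrow> real"
  assumes "finite S"
  obtains M :: nat where "\<And>x. x \<in> S \<Longrightarrow> f x \<le> real M"
proof
  fix x assume "x \<in> S"
  then have "f x \<le> (\<Sum>x\<in>S. \<bar>f x\<bar>)"
    using member_le_sum[of x S "\<lambda>x. \<bar>f x\<bar>"] assms by fastforce
  also have "\<dots> \<le> real (nat \<lceil>\<Sum>x\<in>S. \<bar>f x\<bar>\<rceil>)" by linarith
  finally show "f x \<le> real (nat \<lceil>\<Sum>x\<in>S. \<bar>f x\<bar>\<rceil>)" .
qed

lemma cis_2pi_eq_1_imp_Ints:
  assumes "cis (2 * pi * x) = 1"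
  shows "x \<in> \<int>"
proof -
  have "cos (2 * pi * x) = 1" using assms by (metis cis.simps(1) one_complex.simps(1))
  then obtain k :: int where "2 * pi * x = real_of_int k * 2 * pi"
    using cos_one_2pi_int by auto
  then have "x = of_int k" by simp
  then show ?thesis by simp
qed

text \<open>Concavity of the sine gives Jordan's inequality sin x >= 2 x / pi on [0, pi / 2], and 1
  - cos (2 pi y) = 2 (sin (pi y))^2 >= 2 (2 y)^2.\<close>

lemma one_minus_cos_ge:
  fixes y :: real
  assumes "\<bar>y\<bar> \<le> 1 / 2"
  shows "8 * y\<^sup>2 \<le> 1 - cos (2 * pi * y)"
proof -
  have "convex_on {0..pi / 2} (\<lambda>x. - sin x)"
    by (rule f''_ge0_imp_convex[where f' = "\<lambda>x. - cos x" and f'' = sin])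
      (auto intro!: derivative_eq_intros sin_ge_zero)
  then have jordan: "2 / pi * x \<le> sin x" if "x \<in> {0..pi / 2}" for x
    using convex_onD_Icc'[of 0 "pi / 2" "\<lambda>x. - sin x" x] that by (simp add: field_simps)
  have "pi * \<bar>y\<bar> \<in> {0..pi / 2}" using assms by simp
  then have "2 * \<bar>y\<bar> \<le> sin (pi * \<bar>y\<bar>)" using jordan[of "pi * \<bar>y\<bar>"] by simp
  then have "(2 * \<bar>y\<bar>)\<^sup>2 \<le> (sin (pi * \<bar>y\<bar>))\<^sup>2" by (intro power_mono) auto
  also have "(sin (pi * \<bar>y\<bar>))\<^sup>2 = (sin (pi * y))\<^sup>2" by (cases "y \<ge> 0") auto
  finally show ?thesis
    using cos_double_sin[of "pi * y"] by (simp add: power2_eq_square mult_ac)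
qed

text \<open>Rotating the sum of unit vectors onto the positive real axis turns its length into
  a sum of cosines.\<close>

lemma norm_sum_cis_le:
  fixes w :: "'a \<Rightarrow> real"
  assumes "finite S"
  shows "\<exists>c. \<exists>k :: 'a \<Rightarrow> real. (\<forall>v. k v \<in> \<int>) \<and>
    8 * (\<Sum>v\<in>S. (w v - c - k v)\<^sup>2) \<le> real (card S) - cmod (\<Sum>v\<in>S. cis (2 * pi * w v))"
proof -
  define z where "z = (\<Sum>v\<in>S. cis (2 * pi * w v))"
  define c where "c = Arg z / (2 * pi)"
  \<comment> \<open>Rounding to the nearest integer brings each phase into [-1/2, 1/2], where the
    quadratic bound on the cosine holds; the cosine does not notice the integer.\<close>
  define k :: "'a \<Rightarrow> real" where "k v = of_int (round (w v - c))" for v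
  have "z * cis (- Arg z) = cmod z"
    using rcis_cmod_Arg[of z] by (metis add.right_inverse cis_zero mult.right_neutral rcis_def cis_mult mult.assoc)
  then have "cmod z = Re (\<Sum>v\<in>S. cis (2 * pi * w v) * cis (- Arg z))"
    by (simp add: z_def flip: sum_distrib_right)
  also have "\<dots> = (\<Sum>v\<in>S. cos (2 * pi * (w v - c - k v)))"
  proof -
    have "Re (cis (2 * pi * w v) * cis (- Arg z)) = cos (2 * pi * (w v - c - k v))" for v
    proof -
      have "cis (2 * pi * (w v - c - k v)) = cis (2 * pi * w v - Arg z) * inverse (cis (2 * pi * k v))"
        by (simp add: cis_mult c_def algebra_simps del: cis_multiple_2pi)
      also have "cis (2 * pi * k v) = 1" unfolding k_def by (rule cis_multiple_2pi) simp
      finally have "cis (2 * pi * (w v - c - k v)) = cis (2 * pi * w v - Arg z)" by simp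
      then show ?thesis by (simp add: cis_mult) (metis cis.simps(1))
    qed
    then show ?thesis by simp
  qed
  also have "\<dots> \<le> (\<Sum>v\<in>S. 1 - 8 * (w v - c - k v)\<^sup>2)"
  proof (rule sum_mono)
    fix v
    have "\<bar>w v - c - k v\<bar> \<le> 1 / 2"
      using of_int_round_abs_le[of "w v - c"] by (simp add: k_def abs_minus_commute)
    then show "cos (2 * pi * (w v - c - k v)) \<le> 1 - 8 * (w v - c - k v)\<^sup>2"
      using one_minus_cos_ge[of "w v - c - k v"] by simp
  qed
  also have "\<dots> = real (card S) - 8 * (\<Sum>v\<in>S. (w v - c - k v)\<^sup>2)"
    by (simp add: sum_subtractf sum_distrib_left)
  finally have "8 * (\<Sum>v\<in>S. (w v - c - k v)\<^sup>2) \<le> real (card S) - cmod (\<Sum>v\<in>S. cis (2 * pi * w v))"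
    by (simp add: z_def)
  then show ?thesis by (intro exI[of _ c] exI[of _ k]) (simp add: k_def)
qed

text \<open>Orthogonal projection away from the constants does not lengthen a vector. It is used to
  move a point into the hyperplane that contains the lattice.\<close>

lemma sum_mean_deviation_le:
  fixes f :: "'a \<Rightarrow> real"
  assumes "finite S" "S \<noteq> {}"
  defines "m \<equiv> (\<Sum>v\<in>S. f v) / real (card S)"
  shows "(\<Sum>v\<in>S. f v - m) = 0" "(\<Sum>v\<in>S. (f v - m)\<^sup>2) \<le> (\<Sum>v\<in>S. (f v)\<^sup>2)"
proof -
  have n: "real (card S) > 0" using assms by (simp add: card_gt_0_iff)
  have sf: "(\<Sum>v\<in>S. f v) = real (card S) * m" using n by (simp add: m_def)
  show "(\<Sum>v\<in>S. f v - m) = 0" using sf by (simp add: sum_subtractf)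
  have "(\<Sum>v\<in>S. (f v - m)\<^sup>2) = (\<Sum>v\<in>S. (f v)\<^sup>2) - 2 * m * (\<Sum>v\<in>S. f v) + real (card S) * m\<^sup>2"
    by (simp add: power2_diff sum.distrib sum_subtractf)
      (simp add: mult_ac flip: sum_distrib_left sum_distrib_right)
  also have "\<dots> \<le> (\<Sum>v\<in>S. (f v)\<^sup>2)"
    unfolding sf using mult_nonneg_nonneg[of "real (card S)" "m\<^sup>2"]
    by (simp add: power2_eq_square algebra_simps)
  finally show "(\<Sum>v\<in>S. (f v - m)\<^sup>2) \<le> (\<Sum>v\<in>S. (f v)\<^sup>2)" .
qed

lemma summable_on_prod_PiE:
  fixes f :: "'b \<Rightarrow> real"
  assumes "finite F" "f summable_on UNIV" "\<And>z. f z \<ge> 0"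
  shows "(\<lambda>g. \<Prod>x\<in>F. f (g x)) summable_on (PiE F (\<lambda>_. UNIV))"
  using assms(1)
proof (induction F rule: finite_induct)
  case (insert x F)
  let ?P = "PiE F (\<lambda>_. UNIV :: 'b set)" and ?h = "\<lambda>(y, g). g(x := y)"
  have "(\<lambda>(y, g). f y * (\<Prod>x\<in>F. f (g x))) summable_on UNIV \<times> ?P"
    using insert assms by (intro summable_on_times) (auto intro: prod_nonneg)
  also have "(\<lambda>(y, g). f y * (\<Prod>x\<in>F. f (g x))) = (\<lambda>g. \<Prod>x\<in>insert x F. f (g x)) \<circ> ?h"
  proof (rule ext, clarify)
    fix y and g :: "'a \<Rightarrow> 'b"
    have "(\<Prod>z\<in>F. f ((g(x := y)) z)) = (\<Prod>z\<in>F. f (g z))"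
      using insert.hyps by (intro prod.cong) auto
    then show "f y * (\<Prod>x\<in>F. f (g x)) = ((\<lambda>g. \<Prod>x\<in>insert x F. f (g x)) \<circ> ?h) (y, g)"
      using insert.hyps by simp
  qed
  finally have "(\<lambda>g. \<Prod>x\<in>insert x F. f (g x)) summable_on ?h ` (UNIV \<times> ?P)"
    by (subst summable_on_reindex) (use inj_combinator[OF insert.hyps(2), of "\<lambda>_. UNIV"] in blast)+
  then show ?case by (simp add: PiE_insert_eq)
qed simp

lemma exp_square_int_summable:
  assumes "b > (0::real)"
  shows "(\<lambda>j::int. exp (- b * (of_int j)\<^sup>2)) summable_on UNIV"
proof -
  let ?f = "\<lambda>j::int. exp (- b * (of_int j)\<^sup>2)"
  have "?f summable_on UNIV - {0}"
  proof (rule summable_on_comparison_test)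
    show "(\<lambda>j::int. exp (- b) ^ nat \<bar>j\<bar>) summable_on (UNIV - {0})"
      using power_abs_int_has_sum[of "exp (- b)"] assms by (auto simp: summable_on_def)
    fix j :: int
    have "\<bar>of_int j\<bar> \<le> (of_int j :: real)\<^sup>2"
      using self_le_power[of "\<bar>of_int j :: real\<bar>" 2] by (cases "j = 0") (auto simp flip: of_int_abs)
    then have "?f j \<le> exp (of_nat (nat \<bar>j\<bar>) * (- b))"
      using assms by simp
    also have "\<dots> = exp (- b) ^ nat \<bar>j\<bar>" by (rule exp_of_nat_mult)
    finally show "?f j \<le> exp (- b) ^ nat \<bar>j\<bar>" .
  qed simp
  then have "?f summable_on (UNIV - {0}) \<union> {0}" by (rule summable_on_union) simp
  then show ?thesis by (simp add: Un_commute)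
qed

section \<open>Eigenfunctions of kernels\<close>

text \<open>Read at the row of the starting state, with a character as f, this gives the Fourier
  coefficient of the distribution after k steps.\<close>

lemma kernel_power_eigen:
  fixes f :: "'a \<Rightarrow> complex"
  assumes "finite S" and eig: "\<And>x. x \<in> S \<Longrightarrow> (\<Sum>y\<in>S. complex_of_real (A x y) * f y) = \<mu> * f x"
    and "x \<in> S"
  shows "(\<Sum>y\<in>S. complex_of_real (kernel_power S A k x y) * f y) = \<mu> ^ k * f x"
  using assms(3)
proof (induction k arbitrary: x)
  case 0
  have "(\<Sum>y\<in>S. complex_of_real (kernel_one x y) * f y) = (\<Sum>y\<in>S. if y = x then f y else 0)"
    by (rule sum.cong) (auto simp: kernel_one_def)
  then show ?case using 0 assms(1) by simp
next
  case (Suc k)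
  have "(\<Sum>y\<in>S. complex_of_real (kernel_power S A (Suc k) x y) * f y) =
      (\<Sum>y\<in>S. \<Sum>z\<in>S. complex_of_real (A x z) * (complex_of_real (kernel_power S A k z y) * f y))"
    by (simp add: kernel_mult_def sum_distrib_right mult.assoc)
  also have "\<dots> = (\<Sum>z\<in>S. complex_of_real (A x z) * (\<Sum>y\<in>S. complex_of_real (kernel_power S A k z y) * f y))"
    by (subst sum.swap) (simp add: sum_distrib_left)
  also have "\<dots> = (\<Sum>z\<in>S. \<mu> ^ k * (complex_of_real (A x z) * f z))"
    by (rule sum.cong) (simp_all add: Suc.IH mult.left_commute)
  also have "\<dots> = \<mu> ^ Suc k * f x"
    unfolding sum_distrib_left[symmetric] eig[OF Suc.prems] by simp
  finally show ?case .
qed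

text \<open>The sum C of all absolute entries dominates every row sum, so the entries of the k-th
  power are at most C ^ k and the exponential series of C is a majorant.\<close>

lemma kernel_power_summable:
  assumes "finite S" "x \<in> S"
  shows "summable (\<lambda>k. kernel_power S A k x y / fact k)"
proof -
  define C where "C = (\<Sum>x\<in>S. \<Sum>z\<in>S. \<bar>A x z\<bar>)"
  have C: "(\<Sum>z\<in>S. \<bar>A x z\<bar>) \<le> C" if "x \<in> S" for x
    unfolding C_def using member_le_sum[of x S "\<lambda>x. \<Sum>z\<in>S. \<bar>A x z\<bar>"] assms that by (simp add: sum_nonneg)
  have C0: "C \<ge> 0" by (simp add: C_def sum_nonneg)
  have bound: "\<bar>kernel_power S A k x y\<bar> \<le> C ^ k" if "x \<in> S" for k x
    using that
  proof (induction k arbitrary: x)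
    case 0
    then show ?case by (simp add: kernel_one_def)
  next
    case (Suc k)
    have "\<bar>kernel_power S A (Suc k) x y\<bar> \<le> (\<Sum>z\<in>S. \<bar>A x z * kernel_power S A k z y\<bar>)"
      by (simp add: kernel_mult_def sum_abs)
    also have "\<dots> \<le> (\<Sum>z\<in>S. \<bar>A x z\<bar> * C ^ k)"
      unfolding abs_mult using Suc.IH by (intro sum_mono mult_left_mono) auto
    also have "\<dots> \<le> C * C ^ k"
      unfolding sum_distrib_right[symmetric] using C[OF Suc.prems] C0 by (intro mult_right_mono) auto
    finally show ?case by simp
  qed
  show ?thesis
  proof (rule summable_comparison_test')
    show "summable (\<lambda>k. C ^ k / fact k)"
      using summable_exp[of C] by (simp add: field_simps)
    show "norm (kernel_power S A k x y / fact k) \<le> C ^ k / fact k" for k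
      using bound[OF assms(2), of k] by (simp add: divide_right_mono)
  qed
qed

lemma kernel_exp_eigen:
  fixes f :: "'a \<Rightarrow> complex"
  assumes "finite S" and eig: "\<And>x. x \<in> S \<Longrightarrow> (\<Sum>y\<in>S. complex_of_real (A x y) * f y) = \<mu> * f x"
    and "x \<in> S"
  shows "(\<Sum>y\<in>S. complex_of_real (kernel_exp S A x y) * f y) = exp \<mu> * f x"
proof -
  have "(\<lambda>k. \<Sum>y\<in>S. complex_of_real (kernel_power S A k x y / fact k) * f y) sums
      (\<Sum>y\<in>S. complex_of_real (kernel_exp S A x y) * f y)"
    unfolding kernel_exp_def using assms
    by (intro sums_sum sums_mult2 sums_of_real summable_sums kernel_power_summable)
  moreover have "(\<Sum>y\<in>S. complex_of_real (kernel_power S A k x y / fact k) * f y) =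
      \<mu> ^ k /\<^sub>R fact k * f x" for k
    using kernel_power_eigen[OF assms, of k]
    by (simp add: scaleR_conv_of_real field_simps flip: sum_divide_distrib)
  moreover have "(\<lambda>k. \<mu> ^ k /\<^sub>R fact k * f x) sums (exp \<mu> * f x)"
    by (intro sums_mult2 exp_converges)
  ultimately show ?thesis by (simp add: sums_unique2)
qed

section \<open>The graph Laplacian\<close>

locale sandpile = pair_graph G for G :: "'v pair_pre_digraph" +
  fixes s :: 'v
  assumes conn: "Digraph_Component.connected (with_proj G)"
    and sink: "s \<in> pverts G"
begin

abbreviation V :: "'v set" where "V \<equiv> pverts G"

abbreviation W :: "'v set" where "W \<equiv> pverts G - {s}"

definition nbs :: "'v \<Rightarrow> 'v set" where
  "nbs v = {u \<in> V. (v, u) \<in> parcs G}"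

text \<open>The full Laplacian, with the row of the sink. The reduced one arises by requiring f s =
  0 and evaluating on \<open>W\<close> only.\<close>

definition lap :: "('v \<Rightarrow> real) \<Rightarrow> 'v \<Rightarrow> real" where
  "lap f v = (\<Sum>u\<in>nbs v. f v - f u)"

abbreviation pt :: "'v \<Rightarrow> 'v \<Rightarrow> real" where "pt w \<equiv> (\<lambda>v. if v = w then 1 else 0)"

lemma finite_V [simp]: "finite V" by (rule pair_finite_verts)

lemma finite_nbs [simp]: "finite (nbs v)" by (simp add: nbs_def)

lemma nbs_subset: "nbs v \<subseteq> V" by (auto simp: nbs_def)

lemma arc_sym: "(u, v) \<in> parcs G \<longleftrightarrow> (v, u) \<in> parcs G"
  using pair_sym_arcs by (auto simp: symmetric_def dest: symD)

lemma nbs_sym: "u \<in> V \<Longrightarrow> v \<in> V \<Longrightarrow> u \<in> nbs v \<longleftrightarrow> v \<in> nbs u"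
  using arc_sym by (auto simp: nbs_def)

lemma not_self_nb [simp]: "v \<notin> nbs v"
  using pair_no_loops by (force simp: nbs_def)

lemma deg_eq: "deg G v = card (nbs v)"
proof -
  have "bij_betw snd (out_arcs (with_proj G) v) (nbs v)"
    by (rule bij_betw_byWitness[where f' = "\<lambda>u. (v, u)"])
      (auto simp: out_arcs_def nbs_def in_arcsD2)
  then show ?thesis
    by (simp add: deg_def out_degree_def bij_betw_same_card)
qed

lemma deg_le_card: "deg G v \<le> card V"
  unfolding deg_eq by (intro card_mono nbs_subset) simp

lemma lap_eq: "lap f v = real (deg G v) * f v - (\<Sum>u\<in>nbs v. f u)"
  by (simp add: lap_def sum_subtractf deg_eq)

lemma lap_add: "lap (\<lambda>v. f v + g v) v = lap f v + lap g v"
  by (simp add: lap_def sum.distrib sum_subtractf algebra_simps)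

lemma lap_diff: "lap (\<lambda>v. f v - g v) v = lap f v - lap g v"
  by (simp add: lap_def sum.distrib sum_subtractf algebra_simps)

lemma lap_minus: "lap (\<lambda>v. - f v) v = - lap f v"
  by (simp add: lap_def sum_subtractf)

lemma lap_cmult: "lap (\<lambda>v. c * f v) v = c * lap f v"
  by (simp add: lap_def sum_distrib_left algebra_simps)

lemma lap_const: "lap (\<lambda>v. c) v = 0"
  by (simp add: lap_def)

lemma lap_sum: "lap (\<lambda>v. \<Sum>i\<in>I. f i v) v = (\<Sum>i\<in>I. lap (f i) v)"
  unfolding lap_def sum_subtractf[symmetric] by (rule sum.swap)

lemma lap_cong: "v \<in> V \<Longrightarrow> (\<And>x. x \<in> V \<Longrightarrow> f x = g x) \<Longrightarrow> lap f v = lap g v"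
  unfolding lap_def using nbs_subset[of v] by (intro sum.cong) auto

lemma lap_Ints: "(\<And>x. x \<in> V \<Longrightarrow> f x \<in> \<int>) \<Longrightarrow> v \<in> V \<Longrightarrow> lap f v \<in> \<int>"
  unfolding lap_def using nbs_subset[of v] by (intro Ints_sum Ints_diff) auto

lemma lap_pt:
  "lap (pt w) v = (if v = w then real (deg G v) else if w \<in> nbs v then -1 else 0)"
  by (auto simp: lap_eq)

lemma lap_symmetric: "(\<Sum>v\<in>V. lap f v * g v) = (\<Sum>v\<in>V. f v * lap g v)"
proof -
  have swap: "(\<Sum>v\<in>V. \<Sum>u\<in>nbs v. f u * g v) = (\<Sum>v\<in>V. \<Sum>u\<in>nbs v. f v * g u)"
  proof -
    have "(\<Sum>v\<in>V. \<Sum>u\<in>nbs v. f u * g v) = (\<Sum>u\<in>V. \<Sum>v | v \<in> V \<and> (v, u) \<in> parcs G. f u * g v)"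
      unfolding nbs_def by (rule sum.swap_restrict) auto
    then show ?thesis using arc_sym by (simp add: nbs_def)
  qed
  have "(\<Sum>v\<in>V. lap f v * g v) = (\<Sum>v\<in>V. real (deg G v) * f v * g v) - (\<Sum>v\<in>V. \<Sum>u\<in>nbs v. f u * g v)"
    by (simp add: lap_eq left_diff_distrib sum_subtractf sum_distrib_right)
  also have "\<dots> = (\<Sum>v\<in>V. f v * lap g v)"
    unfolding swap by (simp add: lap_eq right_diff_distrib sum_subtractf sum_distrib_left mult_ac)
  finally show ?thesis .
qed

lemma sum_lap: "(\<Sum>v\<in>V. lap f v) = 0"
  using lap_symmetric[of f "\<lambda>_. 1"] by (simp add: lap_const)

lemma sum_V_eq_W: "f s = 0 \<Longrightarrow> sum f V = sum f W"
  by (intro sum.mono_neutral_right) auto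

text \<open>The weights are concave in the distance to the sink, with the increments decaying
  geometrically fast.\<close>

lemma superharmonic_weights:
  obtains \<phi> :: "'v \<Rightarrow> nat" where "\<phi> s = 0"
    and "\<And>v. v \<in> W \<Longrightarrow> (\<Sum>u\<in>nbs v. \<phi> u) < deg G v * \<phi> v"
proof -
  have reach: "\<exists>k. (v, s) \<in> parcs G ^^ k" if "v \<in> V" for v
  proof -
    have "v \<rightarrow>\<^sup>*\<^bsub>mk_symmetric (with_proj G)\<^esub> s"
      using conn sink that by (auto simp: Digraph_Component.connected_def strongly_connected_def)
    then have "v \<rightarrow>\<^sup>*\<^bsub>with_proj G\<^esub> s"
      using reachable_mk_symmetric_eq[OF sym_arcs] by simp
    then have "(v, s) \<in> (parcs G)\<^sup>*"
      using reachable_rtranclI[of "with_proj G" v s] by simp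
    then show ?thesis by (simp add: rtrancl_power)
  qed
  define d where "d v = (LEAST k. (v, s) \<in> parcs G ^^ k)" for v
  have d: "(v, s) \<in> parcs G ^^ d v" if "v \<in> V" for v
    unfolding d_def using reach[OF that] by (rule LeastI_ex)
  have d_le: "d v \<le> k" if "(v, s) \<in> parcs G ^^ k" for v k
    unfolding d_def using that by (rule Least_le)
  have ds: "d s = 0" using d_le[of s 0] by simp
  have d_nb: "d u \<le> Suc (d v)" if "u \<in> nbs v" "v \<in> V" for u v
    using that d[of v] arc_sym by (intro d_le relpow_Suc_I2) (auto simp: nbs_def)
  have d_pred: "\<exists>w\<in>nbs v. d v = Suc (d w)" if "v \<in> W" for v
  proof -
    have v: "v \<in> V" "v \<noteq> s" using that by auto
    have "d v \<noteq> 0"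
    proof
      assume "d v = 0" with d[OF v(1)] v(2) show False by simp
    qed
    then obtain k where k: "d v = Suc k" using not0_implies_Suc by blast
    with d[OF v(1)] obtain w where w: "(v, w) \<in> parcs G" "(w, s) \<in> parcs G ^^ k"
      by (metis relpow_Suc_D2)
    have "w \<in> nbs v" using w in_arcsD2 by (auto simp: nbs_def)
    moreover have "d w \<le> k" using w by (intro d_le)
    moreover have "d v \<le> Suc (d w)"
      using d_nb[of v w] nbs_sym nbs_subset calculation(1) v by blast
    ultimately show ?thesis using k by (intro bexI[of _ w]) auto
  qed
  define n where "n = card V"
  define M where "M = Max (d ` V)"
  have dM: "d v \<le> M" if "v \<in> V" for v unfolding M_def using that by simp
  have n: "n > 0" unfolding n_def using sink by (auto simp: card_gt_0_iff)
  \<comment> \<open>The increments shrink by a factor n per step away from the sink, so one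
    neighbour that is closer outweighs fewer than n neighbours that are farther. The bound d v <= M
    keeps the natural subtraction exact.\<close>
  define \<phi> where "\<phi> v = (\<Sum>i<d v. n ^ (M - i))" for v
  show ?thesis
  proof
    show "\<phi> s = 0" by (simp add: \<phi>_def ds)
    fix v assume v: "v \<in> W"
    obtain w where w: "w \<in> nbs v" "d v = Suc (d w)" using d_pred[OF v] by blast
    have "\<phi> v = \<phi> w + n ^ (M - d w)" unfolding \<phi>_def w(2) by simp
    moreover have "n ^ (M - d w) = n * n ^ (M - d v)"
      using w dM[of v] v by (simp add: power_Suc[symmetric] Suc_diff_Suc del: power_Suc)
    ultimately have \<phi>w: "\<phi> v = \<phi> w + n * n ^ (M - d v)" by simp
    have \<phi>u: "\<phi> u \<le> \<phi> v + n ^ (M - d v)" if "u \<in> nbs v" for u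
    proof -
      have "\<phi> u \<le> (\<Sum>i<Suc (d v). n ^ (M - i))"
        unfolding \<phi>_def using d_nb[OF that] v by (intro sum_mono2) auto
      then show ?thesis by (simp add: \<phi>_def)
    qed
    have card: "card (nbs v - {w}) < n"
    proof -
      have "nbs v - {w} \<subset> V" using nbs_subset[of v] v w(1) by blast
      then show ?thesis unfolding n_def by (rule psubset_card_mono[rotated]) simp
    qed
    have "(\<Sum>u\<in>nbs v. \<phi> u) = \<phi> w + (\<Sum>u\<in>nbs v - {w}. \<phi> u)"
      using w by (intro sum.remove) auto
    also have "(\<Sum>u\<in>nbs v - {w}. \<phi> u) \<le> card (nbs v - {w}) * (\<phi> v + n ^ (M - d v))"
      using sum_bounded_above[of "nbs v - {w}" \<phi> "\<phi> v + n ^ (M - d v)"] \<phi>u by auto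
    also have "\<phi> w + \<dots> < \<phi> w + n * n ^ (M - d v) + card (nbs v - {w}) * \<phi> v"
      using card n by (simp add: algebra_simps)
    also have "\<dots> = deg G v * \<phi> v"
      using \<phi>w w(1) card_Suc_Diff1[of "nbs v" w] unfolding deg_eq by (metis add.commute finite_nbs mult_Suc)
    finally show "(\<Sum>u\<in>nbs v. \<phi> u) < deg G v * \<phi> v" by simp
  qed
qed

section \<open>Stabilization\<close>

abbreviation step :: "('v \<Rightarrow> nat) \<Rightarrow> ('v \<Rightarrow> nat) \<Rightarrow> bool" where
  "step \<equiv> topple_step G s"

lemma topple_eq:
  assumes "v \<in> W"
  shows "topple G s v \<eta> = (\<lambda>u. if u = v then \<eta> u - deg G v else if u \<in> nbs v - {s} then \<eta> u + 1 else \<eta> u)"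
  by (auto simp: topple_def fun_eq_iff nbs_def in_arcsD2)

lemma real_topple:
  assumes "w \<in> W" "deg G w \<le> \<eta> w" "v \<in> W"
  shows "real (topple G s w \<eta> v) = real (\<eta> v) - lap (pt w) v"
  using assms nbs_sym[of v w] by (auto simp: topple_eq lap_pt)

lemma stable_iff: "stable G s \<eta> \<longleftrightarrow> (\<nexists>\<zeta>. step \<eta> \<zeta>)"
  by (force simp: stable_def topple_step_def)

text \<open>The weighted number of chips drops at every toppling, because the weights are strictly
  superharmonic off the sink and vanish at the sink.\<close>

lemma stable_reachable: "\<exists>\<zeta>. step\<^sup>*\<^sup>* \<eta> \<zeta> \<and> stable G s \<zeta>"
proof -
  obtain \<phi> :: "'v \<Rightarrow> nat" where \<phi>: "\<phi> s = 0"
    "\<And>v. v \<in> W \<Longrightarrow> (\<Sum>u\<in>nbs v. \<phi> u) < deg G v * \<phi> v"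
    using superharmonic_weights by blast
  define \<Phi> where "\<Phi> \<eta> = (\<Sum>v\<in>W. \<eta> v * \<phi> v)" for \<eta>
  have dec: "\<Phi> \<zeta> < \<Phi> \<eta>" if step: "step \<eta> \<zeta>" for \<eta> \<zeta>
  proof -
    obtain v where v: "v \<in> W" "deg G v \<le> \<eta> v" "\<zeta> = topple G s v \<eta>"
      using step by (auto simp: topple_step_def)
    \<comment> \<open>The chips lost at v are added back on the left, so that no truncated
      subtraction enters the sums.\<close>
    have "\<Phi> \<zeta> + deg G v * \<phi> v = (\<Sum>u\<in>W. \<zeta> u * \<phi> u + (if u = v then deg G v * \<phi> v else 0))"
      using v(1) by (simp add: \<Phi>_def sum.distrib)
    also have "\<dots> = (\<Sum>u\<in>W. \<eta> u * \<phi> u + (if u \<in> nbs v then \<phi> u else 0))"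
      by (rule sum.cong) (use v in \<open>auto simp: topple_eq algebra_simps simp flip: add_mult_distrib\<close>)
    also have "\<dots> = \<Phi> \<eta> + (\<Sum>u\<in>W. if u \<in> nbs v then \<phi> u else 0)"
      by (simp add: \<Phi>_def sum.distrib)
    also have "(\<Sum>u\<in>W. if u \<in> nbs v then \<phi> u else 0) = (\<Sum>u\<in>nbs v. \<phi> u)"
      using nbs_subset[of v] \<phi>(1) by (intro sum.mono_neutral_cong) auto
    finally show ?thesis using \<phi>(2)[OF v(1)] by simp
  qed
  show ?thesis
  proof (induction "\<Phi> \<eta>" arbitrary: \<eta> rule: less_induct)
    case less
    show ?case
    proof (cases "stable G s \<eta>")
      case False
      then obtain \<zeta> where "step \<eta> \<zeta>" by (auto simp: stable_iff)
      then show ?thesis using less[OF dec] by (meson converse_rtranclp_into_rtranclp)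
    qed blast
  qed
qed

text \<open>Topplings at distinct vertices commute: toppling one vertex only adds chips elsewhere,
  so the other one stays unstable.\<close>

lemma confluent_step: "confluentp step"
proof -
  have "\<exists>u. step\<^sup>*\<^sup>* y u \<and> step\<^sup>=\<^sup>= z u" if xy: "step x y" and xz: "step x z" for x y z
  proof -
    obtain v where v: "v \<in> W" "deg G v \<le> x v" "y = topple G s v x"
      using xy by (auto simp: topple_step_def)
    obtain w where w: "w \<in> W" "deg G w \<le> x w" "z = topple G s w x"
      using xz by (auto simp: topple_step_def)
    show ?thesis
    proof (cases "v = w")
      case False
      have "topple G s w y = topple G s v z"
        using v w False by (auto simp: topple_eq fun_eq_iff)
      moreover have "deg G w \<le> y w" "deg G v \<le> z v"
        using v w False by (auto simp: topple_eq)
      then have "step y (topple G s w y)" "step z (topple G s v z)"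
        using v(1) w(1) unfolding topple_step_def by blast+
      ultimately show ?thesis by auto
    qed (use v w in auto)
  qed
  then have "strong_confluentp step" by (rule strong_confluentpI)
  then show ?thesis
    by (intro semiconfluentp_imp_confluentp strong_confluentp_into_semiconfluentp)
qed

lemma stabilize_eqI:
  assumes "step\<^sup>*\<^sup>* \<eta> \<zeta>" "stable G s \<zeta>"
  shows "stabilize G s \<eta> = \<zeta>"
  unfolding stabilize_def
proof (rule the_equality)
  fix \<xi> assume \<xi>: "step\<^sup>*\<^sup>* \<eta> \<xi> \<and> stable G s \<xi>"
  obtain u where u: "step\<^sup>*\<^sup>* \<zeta> u" "step\<^sup>*\<^sup>* \<xi> u"
    using confluentpD[OF confluent_step] assms(1) \<xi> by blast
  have "\<zeta> = u" using u(1) assms(2) by (metis converse_rtranclpE stable_iff)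
  moreover have "\<xi> = u" using u(2) \<xi> by (metis converse_rtranclpE stable_iff)
  ultimately show "\<xi> = \<zeta>" by simp
qed (use assms in simp)

lemma steps_stabilize: "step\<^sup>*\<^sup>* \<eta> (stabilize G s \<eta>)"
  and stable_stabilize: "stable G s (stabilize G s \<eta>)"
  using stable_reachable[of \<eta>] stabilize_eqI by auto

text \<open>Extra chips never make a toppling illegal. This is the abelian property behind
  \<open>stabilize_add\<close>: a summand may be stabilised early.\<close>

lemma steps_add:
  assumes "step\<^sup>*\<^sup>* \<eta> \<zeta>"
  shows "step\<^sup>*\<^sup>* (\<lambda>v. \<eta> v + \<tau> v) (\<lambda>v. \<zeta> v + \<tau> v)"
  using assms
proof induction
  case (step \<zeta> \<xi>)
  obtain v where v: "v \<in> W" "deg G v \<le> \<zeta> v" "\<xi> = topple G s v \<zeta>"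
    using step by (auto simp: topple_step_def)
  have "(\<lambda>u. \<xi> u + \<tau> u) = topple G s v (\<lambda>u. \<zeta> u + \<tau> u)"
    using v by (auto simp: topple_eq fun_eq_iff)
  then have "topple_step G s (\<lambda>u. \<zeta> u + \<tau> u) (\<lambda>u. \<xi> u + \<tau> u)"
    using v by (auto simp: topple_step_def intro!: bexI[of _ v])
  then show ?case using step.IH by (rule rtranclp.rtrancl_into_rtrancl[rotated])
qed simp

lemma stabilize_steps: "step\<^sup>*\<^sup>* \<eta> \<zeta> \<Longrightarrow> stabilize G s \<eta> = stabilize G s \<zeta>"
  by (rule stabilize_eqI[OF rtranclp_trans[OF _ steps_stabilize] stable_stabilize])

lemma stabilize_add:
  "stabilize G s (\<lambda>v. stabilize G s \<eta> v + \<tau> v) = stabilize G s (\<lambda>v. \<eta> v + \<tau> v)"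
  by (rule stabilize_steps[OF steps_add[OF steps_stabilize], symmetric])

lemma steps_configs:
  assumes "step\<^sup>*\<^sup>* \<eta> \<zeta>" "\<eta> \<in> configs G s"
  shows "\<zeta> \<in> configs G s"
  using assms
proof induction
  case (step \<zeta> \<xi>)
  then obtain v where "v \<in> W" "deg G v \<le> \<zeta> v" "\<xi> = topple G s v \<zeta>"
    by (auto simp: topple_step_def)
  then show ?case using step nbs_subset[of v] by (auto simp: topple_eq configs_def)
qed

lemma stabilize_configs: "\<eta> \<in> configs G s \<Longrightarrow> stabilize G s \<eta> \<in> configs G s"
  by (rule steps_configs[OF steps_stabilize])

section \<open>Classes modulo the Laplacian\<close>

text \<open>Congruence modulo the integer image of the reduced Laplacian; the condition u s = 0 is
  what reduces it. Real-valued arguments admit negative and not yet integral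
  representatives.\<close>

definition sim :: "('v \<Rightarrow> real) \<Rightarrow> ('v \<Rightarrow> real) \<Rightarrow> bool" where
  "sim f g \<longleftrightarrow> (\<exists>u. (\<forall>v. u v \<in> \<int>) \<and> u s = 0 \<and> (\<forall>v\<in>W. f v - g v = lap u v))"

lemma sim_refl: "(\<And>v. v \<in> W \<Longrightarrow> f v = g v) \<Longrightarrow> sim f g"
  unfolding sim_def by (intro exI[of _ "\<lambda>_. 0"]) (auto simp: lap_const)

lemma sim_sym: "sim f g \<Longrightarrow> sim g f"
  unfolding sim_def
proof clarify
  fix u assume "\<forall>v. u v \<in> \<int>" "u s = 0" "\<forall>v\<in>W. f v - g v = lap u v"
  then show "\<exists>u. (\<forall>v. u v \<in> \<int>) \<and> u s = 0 \<and> (\<forall>v\<in>W. g v - f v = lap u v)"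
    by (intro exI[of _ "\<lambda>v. - u v"]) (auto simp: lap_minus simp flip: \<open>\<forall>v\<in>W. _\<close>[rule_format])
qed

lemma sim_add: "sim f g \<Longrightarrow> sim f' g' \<Longrightarrow> sim (\<lambda>v. f v + f' v) (\<lambda>v. g v + g' v)"
  unfolding sim_def
proof (elim exE conjE)
  fix u u' assume "\<forall>v. u v \<in> \<int>" "u s = 0" "\<forall>v\<in>W. f v - g v = lap u v"
    "\<forall>v. u' v \<in> \<int>" "u' s = 0" "\<forall>v\<in>W. f' v - g' v = lap u' v"
  then show "\<exists>u. (\<forall>v. u v \<in> \<int>) \<and> u s = 0 \<and> (\<forall>v\<in>W. f v + f' v - (g v + g' v) = lap u v)"
    by (intro exI[of _ "\<lambda>v. u v + u' v"]) (auto simp: lap_add algebra_simps)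
qed

lemma sim_trans [trans]: "sim f g \<Longrightarrow> sim g h \<Longrightarrow> sim f h"
  unfolding sim_def
proof (elim exE conjE)
  fix u u' assume "\<forall>v. u v \<in> \<int>" "u s = 0" "\<forall>v\<in>W. f v - g v = lap u v"
    "\<forall>v. u' v \<in> \<int>" "u' s = 0" "\<forall>v\<in>W. g v - h v = lap u' v"
  then show "\<exists>u. (\<forall>v. u v \<in> \<int>) \<and> u s = 0 \<and> (\<forall>v\<in>W. f v - h v = lap u v)"
    by (intro exI[of _ "\<lambda>v. u v + u' v"]) (simp add: lap_add flip: \<open>\<forall>v\<in>W. _ = lap u _\<close>[rule_format] \<open>\<forall>v\<in>W. _ = lap u' _\<close>[rule_format])
qed

lemma steps_sim: "step\<^sup>*\<^sup>* \<eta> \<zeta> \<Longrightarrow> sim (\<lambda>v. real (\<eta> v)) (\<lambda>v. real (\<zeta> v))"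
proof (induction rule: rtranclp_induct)
  case base
  show ?case by (rule sim_refl) simp
next
  case (step \<zeta> \<xi>)
  then obtain w where w: "w \<in> W" "deg G w \<le> \<zeta> w" "\<xi> = topple G s w \<zeta>"
    by (auto simp: topple_step_def)
  have "sim (\<lambda>v. real (\<zeta> v)) (\<lambda>v. real (\<xi> v))"
    unfolding sim_def using w by (intro exI[of _ "pt w"]) (auto simp: real_topple)
  then show ?case using step.IH sim_trans by blast
qed

lemma sim_stabilize: "sim (\<lambda>v. real (stabilize G s \<eta> v)) (\<lambda>v. real (\<eta> v))"
  by (rule sim_sym[OF steps_sim[OF steps_stabilize]])

text \<open>Each vertex holds enough chips of its own for all of its topplings. Other topplings only
  add to it, so any order is legal and induction on their total number works.\<close>

lemma steps_multi_topple:
  fixes u :: "'v \<Rightarrow> nat"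
  assumes "\<And>v. v \<in> W \<Longrightarrow> u v * deg G v \<le> \<eta> v" "u s = 0"
    and "\<And>v. v \<in> W \<Longrightarrow> real (\<zeta> v) = real (\<eta> v) - lap (\<lambda>x. real (u x)) v"
    and "\<And>v. v \<notin> W \<Longrightarrow> \<zeta> v = \<eta> v"
  shows "step\<^sup>*\<^sup>* \<eta> \<zeta>"
  using assms
proof (induction "\<Sum>v\<in>W. u v" arbitrary: u \<eta>)
  case 0
  then have u0: "u v = 0" if "v \<in> V" for v using that by (cases "v = s") auto
  have "lap (\<lambda>x. real (u x)) v = lap (\<lambda>_. 0) v" if "v \<in> W" for v
    using that u0 by (intro lap_cong) auto
  then have "real (\<zeta> v) = real (\<eta> v)" if "v \<in> W" for v
    using 0 that by (simp add: lap_const)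
  then have "\<zeta> v = \<eta> v" for v
    using 0(5)[of v] by (cases "v \<in> W") (simp_all del: Diff_iff)
  then have "\<zeta> = \<eta>" by blast
  then show ?case by simp
next
  case (Suc k)
  then obtain w where w: "w \<in> W" "u w > 0"
    by (metis gr0I sum.neutral Zero_not_Suc)
  have un: "deg G w \<le> \<eta> w"
    using Suc(3)[OF w(1)] w(2) by (cases "u w") auto
  define \<eta>1 where "\<eta>1 = topple G s w \<eta>"
  define u1 where "u1 = u(w := u w - 1)"
  have u: "real (u x) = real (u1 x) + pt w x" for x using w by (simp add: u1_def)
  have "step\<^sup>*\<^sup>* \<eta>1 \<zeta>"
  proof (rule Suc(1))
    have "(\<Sum>v\<in>W. u v) = (\<Sum>v\<in>W. u1 v + (if v = w then 1 else 0))"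
      using w by (intro sum.cong) (auto simp: u1_def)
    then show "k = (\<Sum>v\<in>W. u1 v)" using Suc(2) w(1) by (simp add: sum.distrib)
    show "u1 s = 0" using Suc(4) w(1) by (auto simp: u1_def)
    show "u1 v * deg G v \<le> \<eta>1 v" if "v \<in> W" for v
    proof (cases "v = w")
      case True
      then show ?thesis using Suc(3)[OF w(1)] w by (simp add: u1_def \<eta>1_def topple_eq diff_mult_distrib)
    next
      case False
      then have "\<eta> v \<le> \<eta>1 v" using w by (simp add: \<eta>1_def topple_eq)
      with False show ?thesis using Suc(3)[OF that] by (simp add: u1_def)
    qed
    show "real (\<zeta> v) = real (\<eta>1 v) - lap (\<lambda>x. real (u1 x)) v" if "v \<in> W" for v
      using Suc(5)[OF that] real_topple[where \<eta> = \<eta>, OF w(1) un that] unfolding u lap_add \<eta>1_def by simp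
    show "\<zeta> v = \<eta>1 v" if "v \<notin> W" for v
      using Suc(6)[OF that] that w nbs_subset[of w] by (auto simp: \<eta>1_def topple_eq)
  qed
  moreover have "step \<eta> \<eta>1" using w un by (auto simp: topple_step_def \<eta>1_def)
  ultimately show ?case by (meson converse_rtranclp_into_rtranclp)
qed

section \<open>Recurrent configurations\<close>

abbreviation group :: "('v \<Rightarrow> nat) set" where "group \<equiv> sandpile_group G s"

abbreviation rep :: "('v \<Rightarrow> nat) \<Rightarrow> 'v \<Rightarrow> nat" where "rep \<equiv> stabilize G s"

lemma max_stable_configs: "max_stable G s \<in> configs G s"
  by (auto simp: max_stable_def configs_def)

text \<open>Removes the stability condition on the summand in \<open>sandpile_group\<close>, since
  \<tau> may be replaced by its stabilisation.\<close>

lemma rep_max_add_mem: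
  assumes "\<tau> \<in> configs G s"
  shows "rep (\<lambda>v. max_stable G s v + \<tau> v) \<in> group"
proof -
  have "rep (\<lambda>v. max_stable G s v + \<tau> v) = rep (\<lambda>v. rep \<tau> v + max_stable G s v)"
    unfolding stabilize_add by (simp add: add.commute)
  also have "\<dots> = sandpile_add G s (max_stable G s) (rep \<tau>)"
    by (simp add: sandpile_add_def add.commute)
  finally show ?thesis
    using stable_stabilize stabilize_configs[OF assms] by (auto simp: sandpile_group_def)
qed

lemma groupE:
  assumes "g \<in> group"
  obtains \<sigma> where "\<sigma> \<in> configs G s" "g = rep (\<lambda>v. max_stable G s v + \<sigma> v)"
  using assms by (auto simp: sandpile_group_def sandpile_add_def)

lemma add_configs: "\<eta> \<in> configs G s \<Longrightarrow> \<tau> \<in> configs G s \<Longrightarrow> (\<lambda>v. \<eta> v + \<tau> v) \<in> configs G s"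
  by (simp add: configs_def)

lemma group_configs: "g \<in> group \<Longrightarrow> g \<in> configs G s"
  by (elim groupE) (simp add: stabilize_configs add_configs max_stable_configs)

lemma rep_add_mem:
  assumes "g \<in> group" "\<tau> \<in> configs G s"
  shows "rep (\<lambda>v. g v + \<tau> v) \<in> group"
proof -
  obtain \<sigma> where \<sigma>: "\<sigma> \<in> configs G s" "g = rep (\<lambda>v. max_stable G s v + \<sigma> v)"
    using assms(1) by (rule groupE)
  have "rep (\<lambda>v. g v + \<tau> v) = rep (\<lambda>v. max_stable G s v + (\<sigma> v + \<tau> v))"
    unfolding \<sigma>(2) stabilize_add by (simp add: add.assoc)
  then show ?thesis
    using rep_max_add_mem[OF add_configs[OF \<sigma>(1) assms(2)]] by simp
qed

lemma finite_group: "finite group"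
proof -
  have "group \<subseteq> {g. \<forall>v. (v \<in> W \<longrightarrow> g v \<in> {..card V}) \<and> (v \<notin> W \<longrightarrow> g v = 0)}"
  proof
    fix g assume g: "g \<in> group"
    have "g v \<le> card V" if "v \<in> W" for v
    proof -
      have "stable G s g" using g by (elim groupE) (simp add: stable_stabilize)
      then have "g v < deg G v" using that by (simp add: stable_def)
      also have "deg G v \<le> card V" by (rule deg_le_card)
      finally show ?thesis by simp
    qed
    then show "g \<in> {g. \<forall>v. (v \<in> W \<longrightarrow> g v \<in> {..card V}) \<and> (v \<notin> W \<longrightarrow> g v = 0)}"
      using group_configs[OF g] by (auto simp: configs_def)
  qed
  then show ?thesis
    by (rule finite_subset) (intro finite_set_of_finite_funs, auto)
qed

text \<open>A large multiple of the zero class that recurrent configurations do not feel. With b = c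
  - rep c, a recurrent g comes from a configuration above \<open>max_stable\<close>, hence of the
  form rep c + y. Adding b to it gives c + y, which stabilises through rep c + y back to g.\<close>

lemma absorbed_config:
  obtains b where "b \<in> configs G s" "\<And>v. v \<in> W \<Longrightarrow> M \<le> b v"
    "sim (\<lambda>v. real (b v)) (\<lambda>_. 0)" "\<And>g. g \<in> group \<Longrightarrow> rep (\<lambda>v. g v + b v) = g"
proof -
  \<comment> \<open>The surplus card V covers what is lost by subtracting rep c, whose heights are
    below the degrees.\<close>
  define c where "c v = (if v \<in> W then M + card V else 0)" for v
  define b where "b v = c v - rep c v" for v
  have c: "c \<in> configs G s" by (auto simp: c_def configs_def)
  have rc: "rep c \<in> configs G s" by (rule stabilize_configs[OF c])
  have rc_le: "rep c v < deg G v" if "v \<in> W" for v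
    using stable_stabilize[of c] that by (simp add: stable_def)
  have split: "c v = rep c v + b v" for v
  proof (cases "v \<in> W")
    case True
    then show ?thesis using rc_le[OF True] deg_le_card[of v] by (simp add: b_def c_def)
  next
    case False
    then show ?thesis using rc by (auto simp: b_def c_def configs_def)
  qed
  show ?thesis
  proof
    show "b \<in> configs G s" using c by (auto simp: b_def configs_def)
    show "M \<le> b v" if "v \<in> W" for v
      using that rc_le[OF that] deg_le_card[of v] by (simp add: b_def c_def)
    have "sim (\<lambda>v. real (c v)) (\<lambda>v. real (rep c v))" by (rule sim_sym[OF sim_stabilize])
    then show "sim (\<lambda>v. real (b v)) (\<lambda>_. 0)" by (simp add: sim_def split)
    fix g assume "g \<in> group"
    then obtain \<sigma> where \<sigma>: "\<sigma> \<in> configs G s" "g = rep (\<lambda>v. max_stable G s v + \<sigma> v)"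
      by (rule groupE)
    define y where "y v = max_stable G s v - rep c v + \<sigma> v" for v
    have y: "max_stable G s v + \<sigma> v = rep c v + y v" for v
    proof (cases "v \<in> W")
      case True
      then show ?thesis using rc_le[OF True] by (simp add: y_def max_stable_def)
    next
      case False
      then show ?thesis using rc by (auto simp: y_def max_stable_def configs_def)
    qed
    have "rep (\<lambda>v. g v + b v) = rep (\<lambda>v. max_stable G s v + \<sigma> v + b v)"
      unfolding \<sigma>(2) by (rule stabilize_add)
    also have "\<dots> = rep (\<lambda>v. c v + y v)"
      unfolding y by (simp add: split ac_simps)
    also have "\<dots> = rep (\<lambda>v. rep c v + y v)" by (rule stabilize_add[symmetric])
    also have "\<dots> = g" unfolding \<sigma>(2) y ..
    finally show "rep (\<lambda>v. g v + b v) = g" .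
  qed
qed

text \<open>Adding an absorbed configuration keeps the class and lifts z above
  \<open>max_stable\<close>; stabilising the result gives a recurrent element.\<close>

lemma class_rep:
  assumes "\<And>v. v \<in> W \<Longrightarrow> z v \<in> \<int>"
  obtains g where "g \<in> group" "sim (\<lambda>v. real (g v)) z"
proof -
  let ?m = "max_stable G s"
  obtain M :: nat where M: "\<And>v. v \<in> W \<Longrightarrow> real (?m v) - z v \<le> real M"
    using real_family_bounded_by_nat[of W "\<lambda>v. real (?m v) - z v"] by auto
  obtain b where b: "\<And>v. v \<in> W \<Longrightarrow> M \<le> b v" "sim (\<lambda>v. real (b v)) (\<lambda>_. 0)"
    using absorbed_config by metis
  define \<tau> where "\<tau> v = (if v \<in> W then nat \<lfloor>z v + real (b v) - real (?m v)\<rfloor> else 0)" for v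
  have \<tau>: "real (?m v + \<tau> v) = z v + real (b v)" if v: "v \<in> W" for v
  proof -
    obtain k where k: "z v = of_int k" using assms[OF v] by (elim Ints_cases)
    have "real (?m v) - z v \<le> real (b v)" using M[OF v] b(1)[OF v] by linarith
    then show ?thesis using v unfolding \<tau>_def k by simp
  qed
  show ?thesis
  proof
    show "rep (\<lambda>v. ?m v + \<tau> v) \<in> group"
      by (rule rep_max_add_mem) (simp add: \<tau>_def configs_def)
    have "sim (\<lambda>v. real (?m v + \<tau> v)) (\<lambda>v. z v + real (b v))"
      by (rule sim_refl) (rule \<tau>)
    also have "sim (\<lambda>v. z v + real (b v)) (\<lambda>v. z v + 0)"
      by (intro sim_add b sim_refl) simp
    finally have "sim (\<lambda>v. real (?m v + \<tau> v)) z" by simp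
    with sim_stabilize show "sim (\<lambda>v. real (rep (\<lambda>v. ?m v + \<tau> v) v)) z"
      by (rule sim_trans)
  qed
qed

text \<open>Write the integer function that relates g and h as p - q with p, q >= 0. After an
  absorbed b provides enough chips, toppling p from g + b and q from h + b reaches the same
  configuration, which therefore stabilises to both g and h.\<close>

lemma class_rep_unique:
  assumes g: "g \<in> group" and h: "h \<in> group" and gh: "sim (\<lambda>v. real (g v)) (\<lambda>v. real (h v))"
  shows "g = h"
proof -
  obtain u where u: "\<And>v. u v \<in> \<int>" "u s = 0" "\<And>v. v \<in> W \<Longrightarrow> real (g v) - real (h v) = lap u v"
    using gh unfolding sim_def by blast
  define p where "p v = nat \<lfloor>u v\<rfloor>" for v
  define q where "q v = nat (- \<lfloor>u v\<rfloor>)" for v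
  have upq: "u v = real (p v) - real (q v)" for v
    using u(1)[of v] by (elim Ints_cases) (auto simp: p_def q_def)
  have pq_s: "p s = 0" "q s = 0" using u by (auto simp: p_def q_def)
  obtain M where M: "\<And>v. v \<in> W \<Longrightarrow> real ((p v + q v) * deg G v) \<le> real M"
    using real_family_bounded_by_nat[of W "\<lambda>v. real ((p v + q v) * deg G v)"] by auto
  obtain b where b: "\<And>v. v \<in> W \<Longrightarrow> M \<le> b v"
    "\<And>g. g \<in> group \<Longrightarrow> rep (\<lambda>v. g v + b v) = g"
    using absorbed_config by metis
  have big: "p v * deg G v \<le> b v" "q v * deg G v \<le> b v" if "v \<in> W" for v
  proof -
    have "(p v + q v) * deg G v \<le> b v"
      using M[OF that] b(1)[OF that] by (meson of_nat_le_iff order_trans)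
    then show "p v * deg G v \<le> b v" "q v * deg G v \<le> b v" by (simp_all add: add_mult_distrib)
  qed
  define \<zeta> where "\<zeta> v = (if v \<in> W then nat \<lfloor>real (g v + b v) - lap (\<lambda>x. real (p x)) v\<rfloor> else g v + b v)" for v
  have \<zeta>: "real (\<zeta> v) = real (g v + b v) - lap (\<lambda>x. real (p x)) v" if v: "v \<in> W" for v
  proof -
    obtain k where k: "lap (\<lambda>x. real (p x)) v = of_int k"
      using lap_Ints[of "\<lambda>x. real (p x)" v] v by (auto elim: Ints_cases)
    have "lap (\<lambda>x. real (p x)) v \<le> real (p v * deg G v)"
      by (simp add: lap_eq mult.commute sum_nonneg)
    also have "\<dots> \<le> real (g v + b v)" using big(1)[OF v] by (intro of_nat_mono) simp
    finally show ?thesis using v unfolding \<zeta>_def k by simp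
  qed
  have off: "g v = 0" "h v = 0" if "v \<notin> W" for v
    using group_configs[OF g] group_configs[OF h] that by (auto simp: configs_def)
  have "step\<^sup>*\<^sup>* (\<lambda>v. g v + b v) \<zeta>"
    by (rule steps_multi_topple[of p]) (use big pq_s \<zeta> in \<open>auto simp: \<zeta>_def trans_le_add2 simp del: of_nat_add\<close>)
  then have "rep \<zeta> = g" using stabilize_steps b(2)[OF g] by metis
  moreover have "step\<^sup>*\<^sup>* (\<lambda>v. h v + b v) \<zeta>"
  proof (rule steps_multi_topple[of q])
    show "real (\<zeta> v) = real (h v + b v) - lap (\<lambda>x. real (q x)) v" if "v \<in> W" for v
    proof -
      have "lap u v = lap (\<lambda>x. real (p x)) v - lap (\<lambda>x. real (q x)) v"
        unfolding upq[abs_def] by (rule lap_diff)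
      then show ?thesis using u(3)[OF that] \<zeta>[OF that] by simp
    qed
    show "\<zeta> v = h v + b v" if "v \<notin> W" for v using off that by (simp add: \<zeta>_def del: Diff_iff)
  qed (use big pq_s in \<open>auto simp: trans_le_add2\<close>)
  then have "rep \<zeta> = h" using stabilize_steps b(2)[OF h] by metis
  ultimately show ?thesis by simp
qed

text \<open>The identity is the recurrent representative of the zero class. A second identity e'
  agrees with e since their sum equals both.\<close>

lemma sandpile_id:
  shows sandpile_id_mem: "sandpile_id G s \<in> group"
    and sim_sandpile_id: "sim (\<lambda>v. real (sandpile_id G s v)) (\<lambda>_. 0)"
proof -
  obtain e where e: "e \<in> group" "sim (\<lambda>v. real (e v)) (\<lambda>_. 0)"
    by (rule class_rep[of "\<lambda>_. 0"]) auto
  have id: "sandpile_add G s e g = g" if "g \<in> group" for g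
  proof (rule class_rep_unique[OF _ that])
    show "sandpile_add G s e g \<in> group"
      unfolding sandpile_add_def by (intro rep_add_mem e group_configs that)
    have "sim (\<lambda>v. real (e v) + real (g v)) (\<lambda>v. 0 + real (g v))"
      by (intro sim_add e sim_refl) simp
    then show "sim (\<lambda>v. real (sandpile_add G s e g v)) (\<lambda>v. real (g v))"
      using sim_trans[OF sim_stabilize[of "\<lambda>v. e v + g v"]] by (simp add: sandpile_add_def)
  qed
  have comm: "sandpile_add G s g h = sandpile_add G s h g" for g h
    by (simp add: sandpile_add_def add.commute)
  have "sandpile_id G s = e"
    unfolding sandpile_id_def
  proof (rule the_equality)
    fix e' assume "e' \<in> group \<and> (\<forall>g\<in>group. sandpile_add G s e' g = g \<and> sandpile_add G s g e' = g)"
    then show "e' = e" using id e by metis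
  qed (use e id comm in metis)
  with e show "sandpile_id G s \<in> group" "sim (\<lambda>v. real (sandpile_id G s v)) (\<lambda>_. 0)" by auto
qed

text \<open>Finiteness of the group makes every point mass a rational combination of Laplacians.\<close>

lemma green_function:
  obtains \<gamma> :: "'v \<Rightarrow> 'v \<Rightarrow> real" where "\<And>w. w \<in> W \<Longrightarrow> \<gamma> w s = 0"
    "\<And>w v. w \<in> W \<Longrightarrow> v \<in> W \<Longrightarrow> lap (\<gamma> w) v = pt w v"
proof -
  have "\<exists>f. f s = 0 \<and> (\<forall>v\<in>W. lap f v = pt w v)" if w: "w \<in> W" for w
  proof -
    have "\<exists>g\<in>group. sim (\<lambda>v. real (g v)) (\<lambda>v. real k * pt w v)" for k
      by (rule class_rep[of "\<lambda>v. real k * pt w v"]) auto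
    then obtain r where r: "\<And>k. r k \<in> group" "\<And>k. sim (\<lambda>v. real (r k v)) (\<lambda>v. real k * pt w v)"
      by metis
    \<comment> \<open>Pigeonhole: two multiples k < l of the chip at w share a representative, so l
      - k times the point mass is the Laplacian of an integer function vanishing at the
      sink.\<close>
    have "\<not> inj r"
    proof
      assume "inj r"
      then have "finite (UNIV :: nat set)"
        using r(1) finite_group by (metis finite_imageD finite_subset image_subset_iff)
      then show False by simp
    qed
    then obtain k l where kl: "k < l" "r k = r l"
      unfolding inj_def by (metis linorder_neqE_nat)
    have "sim (\<lambda>v. real l * pt w v) (\<lambda>v. real k * pt w v)"
      using sim_trans[OF sim_sym[OF r(2)[of l]]] r(2)[of k] kl by simp
    then obtain u where u: "u s = 0" "\<And>v. v \<in> W \<Longrightarrow> real l * pt w v - real k * pt w v = lap u v"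
      unfolding sim_def by blast
    have "lap (\<lambda>v. inverse (real l - real k) * u v) v = pt w v" if "v \<in> W" for v
      unfolding lap_cmult u(2)[OF that, symmetric] using kl by (simp add: field_simps)
    then show ?thesis using u(1) by (intro exI[of _ "\<lambda>v. inverse (real l - real k) * u v"]) simp
  qed
  then show ?thesis using that by metis
qed

section \<open>Characters of the sandpile group\<close>

text \<open>The potential is determined by \<open>h\<close> only on \<open>V\<close>; off \<open>V\<close> its values are arbitrary.\<close>

definition pot :: "('v \<Rightarrow> real) \<Rightarrow> 'v \<Rightarrow> real" where
  "pot h = (SOME f. f s = 0 \<and> (\<forall>v\<in>W. lap f v = h v))"

lemma pot_sink: "pot h s = 0" and lap_pot: "v \<in> W \<Longrightarrow> lap (pot h) v = h v"
proof -
  obtain \<gamma> where \<gamma>: "\<And>w. w \<in> W \<Longrightarrow> \<gamma> w s = 0"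
    "\<And>w v. w \<in> W \<Longrightarrow> v \<in> W \<Longrightarrow> lap (\<gamma> w) v = pt w v"
    using green_function by blast
  have "(\<Sum>w\<in>W. h w * \<gamma> w s) = 0 \<and> (\<forall>v\<in>W. lap (\<lambda>x. \<Sum>w\<in>W. h w * \<gamma> w x) v = h v)"
  proof (intro conjI ballI)
    fix v assume v: "v \<in> W"
    have "lap (\<lambda>x. \<Sum>w\<in>W. h w * \<gamma> w x) v = (\<Sum>w\<in>W. h w * pt w v)"
      unfolding lap_sum lap_cmult using \<gamma>(2) v by (intro sum.cong) auto
    also have "\<dots> = (\<Sum>w\<in>W. if v = w then h w else 0)" by (rule sum.cong) auto
    also have "\<dots> = h v" using v by (subst sum.delta') auto
    finally show "lap (\<lambda>x. \<Sum>w\<in>W. h w * \<gamma> w x) v = h v" .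
  qed (simp add: \<gamma>(1))
  then have "pot h s = 0 \<and> (\<forall>v\<in>W. lap (pot h) v = h v)"
    unfolding pot_def by (rule someI[of "\<lambda>f. f s = 0 \<and> (\<forall>v\<in>W. lap f v = h v)"])
  then show "pot h s = 0" "v \<in> W \<Longrightarrow> lap (pot h) v = h v" by auto
qed

lemma pot_lap_symmetric:
  assumes "f s = 0"
  shows "(\<Sum>v\<in>W. pot h v * lap f v) = (\<Sum>v\<in>W. h v * f v)"
proof -
  have "(\<Sum>v\<in>W. pot h v * lap f v) = (\<Sum>v\<in>V. pot h v * lap f v)"
    by (rule sum_V_eq_W[symmetric]) (simp add: pot_sink)
  also have "\<dots> = (\<Sum>v\<in>V. lap (pot h) v * f v)" by (rule lap_symmetric[symmetric])
  also have "\<dots> = (\<Sum>v\<in>W. lap (pot h) v * f v)" by (rule sum_V_eq_W) (simp add: assms)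
  also have "\<dots> = (\<Sum>v\<in>W. h v * f v)" using lap_pot by simp
  finally show ?thesis .
qed

lemma sum_pot_symmetric: "(\<Sum>v\<in>W. pot h v * g v) = (\<Sum>v\<in>W. h v * pot g v)"
  using pot_lap_symmetric[of "pot g" h, OF pot_sink] lap_pot by simp

text \<open>Injectivity from solvability: by symmetry, pairing the Laplacian of f with the potential
  of a point mass at v returns the value of f at v.\<close>

lemma lap_eq_0_imp:
  assumes "f s = 0" "\<And>v. v \<in> W \<Longrightarrow> lap f v = 0" "v \<in> V"
  shows "f v = 0"
proof (cases "v = s")
  case False
  then have v: "v \<in> W" using assms by simp
  have "0 = (\<Sum>x\<in>W. pot (pt v) x * lap f x)" using assms(2) by simp
  also have "\<dots> = (\<Sum>x\<in>W. pt v x * f x)" by (rule pot_lap_symmetric[of f "pt v", OF assms(1)])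
  also have "\<dots> = (\<Sum>x\<in>W. if x = v then f x else 0)" by (rule sum.cong) auto
  also have "\<dots> = f v" using v by (subst sum.delta) auto
  finally show ?thesis by simp
qed (use assms in simp)

definition chi :: "('v \<Rightarrow> real) \<Rightarrow> ('v \<Rightarrow> real) \<Rightarrow> complex" where
  "chi h g = cis (2 * pi * (\<Sum>v\<in>W. pot h v * g v))"

lemma chi_sym: "chi h g = chi g h"
  unfolding chi_def sum_pot_symmetric[of h] by (simp only: mult.commute[of "pot g _"])

lemma chi_add: "chi h (\<lambda>v. g v + g' v) = chi h g * chi h g'"
  by (simp add: chi_def cis_mult distrib_left sum.distrib)

lemma chi_diff: "chi h (\<lambda>v. g v - g' v) = chi h g * cnj (chi h g')"
  by (simp add: chi_def cis_mult cis_cnj right_diff_distrib sum_subtractf)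

lemma chi_zero: "chi h (\<lambda>_. 0) = 1"
  by (simp add: chi_def)

lemma norm_chi [simp]: "cmod (chi h g) = 1"
  by (simp add: chi_def)

lemma chi_pt: "w \<in> W \<Longrightarrow> chi h (pt w) = cis (2 * pi * pot h w)"
  unfolding chi_def by (simp add: if_distrib[of "(*) _"] cong: if_cong)

text \<open>Moving the Laplacian from u to the potential turns the change of the phase into the
  integer sum of h v * u v. Thus an integral h gives a character of the quotient.\<close>

lemma chi_sim:
  assumes "sim g g'" "\<And>v. v \<in> W \<Longrightarrow> h v \<in> \<int>"
  shows "chi h g = chi h g'"
proof -
  obtain u where u: "\<And>v. u v \<in> \<int>" "u s = 0" "\<And>v. v \<in> W \<Longrightarrow> g v - g' v = lap u v"
    using assms(1) unfolding sim_def by blast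
  have "(\<Sum>v\<in>W. pot h v * (g v - g' v)) = (\<Sum>v\<in>W. pot h v * lap u v)"
    using u by simp
  also have "\<dots> = (\<Sum>v\<in>W. h v * u v)" by (rule pot_lap_symmetric) (rule u)
  finally have "chi h (\<lambda>v. g v - g' v) = cis (2 * pi * (\<Sum>v\<in>W. h v * u v))"
    by (simp add: chi_def)
  also have "\<dots> = 1"
    using assms(2) u(1) by (intro cis_multiple_2pi Ints_sum Ints_mult) auto
  finally have "chi h g * cnj (chi h g') * chi h g' = chi h g'" by (simp add: chi_diff)
  moreover have "cnj (chi h g') * chi h g' = 1"
    by (simp add: mult.commute[of "cnj _"] complex_norm_square[symmetric])
  ultimately show ?thesis by (simp add: mult.assoc)
qed

lemma sim_if_pot_Ints:
  assumes "\<And>v. v \<in> V \<Longrightarrow> pot h v - pot g v \<in> \<int>"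
  shows "sim h g"
  unfolding sim_def
\<comment> \<open>The witness is cut to 0 off \<open>V\<close>, where potentials are arbitrary while
  \<open>sim\<close> asks for integers everywhere.\<close>
proof (intro exI[of _ "\<lambda>v. if v \<in> V then pot h v - pot g v else 0"] conjI allI ballI)
  fix v assume v: "v \<in> W"
  have "lap (\<lambda>v. if v \<in> V then pot h v - pot g v else 0) v = lap (\<lambda>v. pot h v - pot g v) v"
    using v by (intro lap_cong) auto
  then show "h v - g v = lap (\<lambda>v. if v \<in> V then pot h v - pot g v else 0) v"
    using v by (simp add: lap_diff lap_pot)
qed (use assms in \<open>auto simp: pot_sink\<close>)

text \<open>If the character is 1 on every single chip, the potential of z is integral on
  \<open>V\<close> and itself witnesses that z lies in the zero class.\<close>

lemma chi_separates:
  assumes "\<not> sim z (\<lambda>_. 0)"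
  obtains w where "w \<in> W" "chi z (pt w) \<noteq> 1"
proof -
  have "\<exists>w\<in>W. chi z (pt w) \<noteq> 1"
  proof (rule ccontr)
    assume *: "\<not> ?thesis"
    have pot0: "pot (\<lambda>_. 0) v = 0" if "v \<in> V" for v
      using lap_eq_0_imp[of "pot (\<lambda>_. 0)" v] pot_sink lap_pot that by simp
    have "pot z v - pot (\<lambda>_. 0) v \<in> \<int>" if v: "v \<in> V" for v
    proof (cases "v = s")
      case False
      then have "cis (2 * pi * pot z v) = 1" using * v chi_pt[of v z] by auto
      then show ?thesis using pot0[OF v] cis_2pi_eq_1_imp_Ints by simp
    qed (simp add: pot_sink)
    then show False using assms sim_if_pot_Ints by blast
  qed
  then show ?thesis using that by blast
qed

section \<open>Orthogonality of the characters\<close>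

abbreviation rl :: "('v \<Rightarrow> nat) \<Rightarrow> 'v \<Rightarrow> real" where "rl g \<equiv> (\<lambda>v. real (g v))"

lemma chip_configs: "v \<in> V \<Longrightarrow> chip s v \<in> configs G s"
  by (auto simp: chip_def configs_def)

lemma chi_rep: "(\<And>v. v \<in> W \<Longrightarrow> h v \<in> \<int>) \<Longrightarrow>
    chi h (rl (rep (\<lambda>u. g u + c u))) = chi h (rl g) * chi h (rl c)"
  using chi_sim[OF sim_stabilize] by (simp add: chi_add)

lemma rl_chip: "w \<in> W \<Longrightarrow> rl (chip s w) = pt w"
  by (auto simp: chip_def)

text \<open>Adding a chip at a separating vertex permutes the group and multiplies the sum by a
  number other than 1, so the sum vanishes.\<close>

lemma sum_chi:
  assumes "\<And>v. v \<in> W \<Longrightarrow> z v \<in> \<int>"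
  shows "(\<Sum>h\<in>group. chi (rl h) z) = (if sim z (\<lambda>_. 0) then of_nat (card group) else 0)"
proof (cases "sim z (\<lambda>_. 0)")
  case True
  have "chi (rl h) z = 1" for h
    using chi_sim[OF True, of "rl h"] by (simp add: chi_zero)
  with True show ?thesis by simp
next
  case False
  then obtain w where w: "w \<in> W" "chi z (pt w) \<noteq> 1" by (rule chi_separates)
  define \<beta> where "\<beta> h = rep (\<lambda>v. h v + chip s w v)" for h
  have "inj_on \<beta> group"
  proof (rule inj_onI)
    fix g h assume gh: "g \<in> group" "h \<in> group" "\<beta> g = \<beta> h"
    have \<beta>: "sim (rl (\<beta> g)) (\<lambda>v. real (g v + chip s w v))" for g
      unfolding \<beta>_def by (rule sim_stabilize)
    have "sim (\<lambda>v. real (g v + chip s w v)) (\<lambda>v. real (h v + chip s w v))"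
      using sim_trans[OF sim_sym[OF \<beta>[of g]], unfolded gh(3), OF \<beta>[of h]] .
    then have "sim (rl g) (rl h)" by (simp add: sim_def)
    then show "g = h" using gh class_rep_unique by blast
  qed
  moreover have "\<beta> ` group \<subseteq> group"
    unfolding \<beta>_def using w by (auto intro!: rep_add_mem chip_configs)
  ultimately have bij: "bij_betw \<beta> group group"
    using endo_inj_surj[OF finite_group] by (auto simp: bij_betw_def)
  have "(\<Sum>h\<in>group. chi (rl h) z) = (\<Sum>h\<in>group. chi (rl (\<beta> h)) z)"
    by (rule sum.reindex_bij_betw[OF bij, symmetric])
  also have "\<dots> = (\<Sum>h\<in>group. chi (rl h) z * chi z (pt w))"
    unfolding \<beta>_def chi_sym[of _ z] using chi_rep[OF assms] rl_chip[OF w(1)] by simp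
  also have "\<dots> = (\<Sum>h\<in>group. chi (rl h) z) * chi z (pt w)"
    by (rule sum_distrib_right[symmetric])
  finally show ?thesis using w(2) False by simp
qed

lemma sum_chi_chi:
  assumes "g \<in> group" "g' \<in> group"
  shows "(\<Sum>h\<in>group. chi (rl h) (rl g) * cnj (chi (rl h) (rl g'))) =
    (if g = g' then of_nat (card group) else 0)"
proof -
  have "sim (\<lambda>v. real (g v) - real (g' v)) (\<lambda>_. 0) \<longleftrightarrow> sim (rl g) (rl g')"
    by (simp add: sim_def)
  also have "\<dots> \<longleftrightarrow> g = g'"
    using class_rep_unique[OF assms] sim_refl[of "rl g" "rl g'"] by auto
  finally show ?thesis
    using sum_chi[of "\<lambda>v. real (g v) - real (g' v)"] by (simp add: chi_diff)
qed

lemma chi_id: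
  assumes "\<And>v. v \<in> W \<Longrightarrow> h v \<in> \<int>"
  shows "chi h (rl (sandpile_id G s)) = 1" "chi (rl (sandpile_id G s)) h = 1"
  using chi_sim[OF sim_sandpile_id assms] by (simp_all add: chi_zero chi_sym[of _ h])

lemma card_group_pos: "card group > 0"
  using finite_group sandpile_id_mem by (auto simp: card_gt_0_iff)

section \<open>Plancherel's formula and the spectrum of the chains\<close>

lemma plancherel:
  fixes q :: "('v \<Rightarrow> nat) \<Rightarrow> real"
  shows "(\<Sum>h\<in>group. (cmod (\<Sum>g\<in>group. q g * chi (rl h) (rl g)))\<^sup>2) =
    real (card group) * (\<Sum>g\<in>group. (q g)\<^sup>2)"
proof -
  let ?c = "\<lambda>h g. chi (rl h) (rl g)"
  have "complex_of_real (\<Sum>h\<in>group. (cmod (\<Sum>g\<in>group. q g * ?c h g))\<^sup>2) =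
      (\<Sum>h\<in>group. (\<Sum>g\<in>group. q g * ?c h g) * cnj (\<Sum>g'\<in>group. q g' * ?c h g'))"
    by (simp only: of_real_sum complex_norm_square)
  also have "\<dots> = (\<Sum>h\<in>group. \<Sum>g\<in>group. \<Sum>g'\<in>group. q g * q g' * (?c h g * cnj (?c h g')))"
    by (simp add: sum_product mult_ac)
  also have "\<dots> = (\<Sum>g\<in>group. \<Sum>h\<in>group. \<Sum>g'\<in>group. q g * q g' * (?c h g * cnj (?c h g')))"
    by (rule sum.swap)
  also have "\<dots> = (\<Sum>g\<in>group. \<Sum>g'\<in>group. \<Sum>h\<in>group. q g * q g' * (?c h g * cnj (?c h g')))"
    by (intro sum.cong refl sum.swap)
  also have "\<dots> = (\<Sum>g\<in>group. \<Sum>g'\<in>group. if g = g' then of_real ((q g)\<^sup>2) * of_nat (card group) else 0)"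
    by (intro sum.cong refl) (simp add: sum_distrib_left[symmetric] sum_chi_chi power2_eq_square)
  also have "\<dots> = complex_of_real (real (card group) * (\<Sum>g\<in>group. (q g)\<^sup>2))"
    by (simp add: finite_group sum_distrib_left mult.commute)
  finally show ?thesis by (simp only: of_real_eq_iff)
qed

text \<open>The uniform distribution has only the Fourier coefficient of the trivial character,
  which is indexed by the identity and equals 1. Subtracting it removes exactly that term from
  Plancherel's formula.\<close>

lemma L2_dist_uniform:
  fixes p :: "('v \<Rightarrow> nat) \<Rightarrow> real"
  assumes c: "\<And>h. h \<in> group \<Longrightarrow> (\<Sum>g\<in>group. p g * chi (rl h) (rl g)) = c h"
    and c_id: "c (sandpile_id G s) = 1"
  shows "(L2_dist group p (uniform_on group))\<^sup>2 = (\<Sum>h\<in>group - {sandpile_id G s}. (cmod (c h))\<^sup>2)"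
proof -
  let ?m = "real (card group)" and ?e = "sandpile_id G s"
  have hat: "(\<Sum>g\<in>group. complex_of_real (p g - 1 / ?m) * chi (rl h) (rl g)) = (if h = ?e then 0 else c h)"
    if h: "h \<in> group" for h
  proof -
    have "sim (rl h) (\<lambda>_. 0) \<longleftrightarrow> h = ?e"
      using class_rep_unique[OF h sandpile_id_mem] sim_sandpile_id sim_sym sim_trans by blast
    then have "(\<Sum>g\<in>group. chi (rl h) (rl g)) = (if h = ?e then of_nat (card group) else 0)"
      using sum_chi[of "rl h"] by (simp add: chi_sym[of "rl h"])
    moreover have "(\<Sum>g\<in>group. complex_of_real (p g - 1 / ?m) * chi (rl h) (rl g)) =
        (\<Sum>g\<in>group. p g * chi (rl h) (rl g)) - (\<Sum>g\<in>group. chi (rl h) (rl g)) / ?m"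
      by (simp add: left_diff_distrib sum_subtractf sum_divide_distrib)
    ultimately show ?thesis using c[OF h] c_id card_group_pos by simp
  qed
  have "(L2_dist group p (uniform_on group))\<^sup>2 = ?m * (\<Sum>g\<in>group. (p g - 1 / ?m)\<^sup>2)"
    by (simp add: L2_dist_def uniform_on_def sum_nonneg)
  also have "\<dots> = (\<Sum>h\<in>group. (cmod (if h = ?e then 0 else c h))\<^sup>2)"
    unfolding plancherel[symmetric] by (intro sum.cong refl) (simp only: hat)
  also have "\<dots> = (\<Sum>h\<in>group - {?e}. (cmod (c h))\<^sup>2)"
    using finite_group sandpile_id_mem by (subst sum.remove[of _ ?e]) auto
  finally show ?thesis .
qed

text \<open>The average of the character over the added chips. The sink contributes the summand 1,
  its potential being 0.\<close>

definition ev :: "('v \<Rightarrow> nat) \<Rightarrow> complex" where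
  "ev h = (\<Sum>v\<in>V. cis (2 * pi * pot (rl h) v)) / of_nat (card V)"

lemma card_V_pos: "card V > 0"
  using sink by (auto simp: card_gt_0_iff)

lemma chi_chip: "v \<in> V \<Longrightarrow> chi h (rl (chip s v)) = cis (2 * pi * pot h v)"
  by (cases "v = s") (simp_all add: chip_def[of s s] chi_zero pot_sink rl_chip chi_pt)

lemma ev_id: "ev (sandpile_id G s) = 1"
proof -
  have "cis (2 * pi * pot (rl (sandpile_id G s)) v) = 1" if "v \<in> V" for v
    using chi_id(2)[of "rl (chip s v)"] chi_chip[OF that] by simp
  then show ?thesis using sink by (auto simp: ev_def)
qed

text \<open>Characters ignore stabilisation, so adding a chip at v multiplies the character by its
  value on that chip, independently of g.\<close>

lemma sandpile_kernel_eigen: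
  assumes "g \<in> group"
  shows "(\<Sum>g'\<in>group. complex_of_real (sandpile_kernel G s g g') * chi (rl h) (rl g')) =
    ev h * chi (rl h) (rl g)"
proof -
  let ?n = "complex_of_nat (card V)" and ?r = "\<lambda>v. rep (\<lambda>u. g u + chip s v u)"
  have "(\<Sum>g'\<in>group. complex_of_real (sandpile_kernel G s g g') * chi (rl h) (rl g')) =
      (\<Sum>g'\<in>group. (\<Sum>v\<in>V. if ?r v = g' then chi (rl h) (rl g') else 0) / ?n)"
  proof (rule sum.cong[OF refl])
    fix g'
    have "(\<Sum>v\<in>V. if ?r v = g' then chi (rl h) (rl g') else 0) =
        of_nat (card {v \<in> V. ?r v = g'}) * chi (rl h) (rl g')"
      by (simp add: sum.If_cases Int_def)
    then show "complex_of_real (sandpile_kernel G s g g') * chi (rl h) (rl g') =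
        (\<Sum>v\<in>V. if ?r v = g' then chi (rl h) (rl g') else 0) / ?n"
      by (simp add: sandpile_kernel_def)
  qed
  also have "\<dots> = (\<Sum>v\<in>V. \<Sum>g'\<in>group. if ?r v = g' then chi (rl h) (rl g') else 0) / ?n"
    by (subst sum.swap) (rule sum_divide_distrib[symmetric])
  also have "(\<Sum>v\<in>V. \<Sum>g'\<in>group. if ?r v = g' then chi (rl h) (rl g') else 0) =
      (\<Sum>v\<in>V. chi (rl h) (rl g) * cis (2 * pi * pot (rl h) v))"
  proof (rule sum.cong[OF refl])
    fix v assume v: "v \<in> V"
    have "?r v \<in> group" using assms chip_configs[OF v] by (rule rep_add_mem)
    then show "(\<Sum>g'\<in>group. if ?r v = g' then chi (rl h) (rl g') else 0) =
        chi (rl h) (rl g) * cis (2 * pi * pot (rl h) v)"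
      using finite_group chi_rep[of "rl h" g "chip s v"] chi_chip[OF v] by simp
  qed
  also have "\<dots> / ?n = ev h * chi (rl h) (rl g)"
    by (simp add: ev_def sum_distrib_left[symmetric] mult.commute)
  finally show ?thesis .
qed

lemma L2_dist_discrete:
  "(L2_dist group (discrete_dist G s t) (uniform_on group))\<^sup>2 =
    (\<Sum>h\<in>group - {sandpile_id G s}. (cmod (ev h ^ t))\<^sup>2)"
proof (rule L2_dist_uniform)
  fix h assume "h \<in> group"
  show "(\<Sum>g\<in>group. complex_of_real (discrete_dist G s t g) * chi (rl h) (rl g)) = ev h ^ t"
    using kernel_power_eigen[OF finite_group sandpile_kernel_eigen sandpile_id_mem, of t h] chi_id(1)[of "rl h"]
    by (simp add: discrete_dist_def)
qed (simp add: ev_id)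

lemma L2_dist_continuous:
  "(L2_dist group (continuous_dist G s t) (uniform_on group))\<^sup>2 =
    (\<Sum>h\<in>group - {sandpile_id G s}. (cmod (exp (- of_real t * (1 - ev h))))\<^sup>2)"
proof (rule L2_dist_uniform)
  fix h assume "h \<in> group"
  let ?A = "\<lambda>\<eta> \<zeta>. - t * (kernel_one \<eta> \<zeta> - sandpile_kernel G s \<eta> \<zeta>)"
  have "(\<Sum>g'\<in>group. complex_of_real (?A g g') * chi (rl h) (rl g')) =
      - of_real t * (1 - ev h) * chi (rl h) (rl g)" if g: "g \<in> group" for g
  proof -
    have one: "(\<Sum>g'\<in>group. complex_of_real (kernel_one g g') * chi (rl h) (rl g')) = chi (rl h) (rl g)"
      using kernel_power_eigen[OF finite_group sandpile_kernel_eigen g, of 0 h] by simp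
    have "(\<Sum>g'\<in>group. complex_of_real (?A g g') * chi (rl h) (rl g')) =
        - of_real t * ((\<Sum>g'\<in>group. complex_of_real (kernel_one g g') * chi (rl h) (rl g')) -
          (\<Sum>g'\<in>group. complex_of_real (sandpile_kernel G s g g') * chi (rl h) (rl g')))"
      unfolding sum_subtractf[symmetric] sum_distrib_left
      by (rule sum.cong) (simp_all add: algebra_simps)
    then show ?thesis unfolding one sandpile_kernel_eigen[OF g] by (simp add: algebra_simps)
  qed
  from kernel_exp_eigen[OF finite_group this sandpile_id_mem]
  show "(\<Sum>g\<in>group. complex_of_real (continuous_dist G s t g) * chi (rl h) (rl g)) =
      exp (- of_real t * (1 - ev h))"
    using chi_id(1)[of "rl h"] by (simp add: continuous_dist_def)
qed (simp add: ev_id)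

section \<open>The Laplacian lattice\<close>

definition lattice :: "('v \<Rightarrow> real) set" where
  "lattice = {x. (\<forall>v. v \<notin> V \<longrightarrow> x v = 0) \<and> (\<Sum>v\<in>V. x v) = 0 \<and> (\<forall>v\<in>V. lap x v \<in> \<int>)}"

definition form :: "('v \<Rightarrow> real) \<Rightarrow> ('v \<Rightarrow> real) \<Rightarrow> real" where
  "form x y = (\<Sum>v\<in>V. x v * y v)"

definition row :: "'v \<Rightarrow> 'v \<Rightarrow> real" where
  "row w = (\<lambda>v. if v \<in> V then lap (pt w) v else 0)"

lemma row_mem: "w \<in> V \<Longrightarrow> row w \<in> lattice"
proof -
  assume w: "w \<in> V"
  have "row w v \<in> \<int>" for v
    unfolding row_def using lap_Ints[of "pt w" v] by auto
  moreover have "(\<Sum>v\<in>V. row w v) = 0" using sum_lap[of "pt w"] by (simp add: row_def)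
  ultimately show ?thesis using lap_Ints by (auto simp: lattice_def) (simp add: row_def)
qed

text \<open>By symmetry of the Laplacian. The integrality condition in \<open>lattice\<close> thus
  says that the pairing with every row is an integer, which is the duality.\<close>

lemma form_row:
  assumes "w \<in> V"
  shows "form x (row w) = lap x w"
proof -
  have "form x (row w) = (\<Sum>v\<in>V. x v * lap (pt w) v)" by (simp add: form_def row_def)
  also have "\<dots> = (\<Sum>v\<in>V. lap x v * pt w v)" by (rule lap_symmetric[symmetric])
  also have "\<dots> = (\<Sum>v\<in>V. if v = w then lap x v else 0)" by (rule sum.cong) auto
  also have "\<dots> = lap x w" using assms by simp
  finally show ?thesis .
qed

text \<open>Source of the factor d^2 + d: the diagonal entry is the degree, and as many other
  entries are -1.\<close>

lemma form_row_row:
  assumes "w \<in> V"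
  shows "form (row w) (row w) = (real (deg G w))\<^sup>2 + real (deg G w)"
proof -
  have "lap (row w) w = (\<Sum>u\<in>nbs w. real (deg G w) + 1)"
    unfolding lap_def
  proof (rule sum.cong)
    fix u assume u: "u \<in> nbs w"
    then have "u \<in> V" "u \<noteq> w" using nbs_subset not_self_nb by blast+
    then show "row w w - row w u = real (deg G w) + 1"
      using u assms nbs_sym[of u w] by (simp add: row_def lap_pt)
  qed simp
  then show ?thesis unfolding form_row[OF assms]
    by (simp add: deg_eq power2_eq_square distrib_left)
qed

text \<open>Subtracting the value at the sink reduces to injectivity of the reduced Laplacian; so x
  is constant on \<open>V\<close>, and the sum condition makes the constant 0.\<close>

lemma lattice_eq_0:
  assumes "x \<in> lattice" "\<And>v. v \<in> W \<Longrightarrow> lap x v = 0"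
  shows "x = 0"
proof -
  have "x v - x s = 0" if "v \<in> V" for v
  proof (rule lap_eq_0_imp[OF _ _ that])
    show "lap (\<lambda>v. x v - x s) v = 0" if "v \<in> W" for v
      using assms(2)[OF that] by (simp add: lap_diff lap_const)
  qed simp
  then have const: "x v = x s" if "v \<in> V" for v using that by simp
  then have "(\<Sum>v\<in>V. x v) = real (card V) * x s" by simp
  then have "x s = 0" using assms(1) sink by (auto simp: lattice_def)
  then have "x v = 0" for v using const[of v] assms(1) by (cases "v \<in> V") (auto simp: lattice_def)
  then show ?thesis by (simp add: fun_eq_iff)
qed

lemma lap_square_le:
  assumes "v \<in> V"
  shows "(lap x v)\<^sup>2 \<le> ((real (card V))\<^sup>2 + real (card V)) * form x x"
proof -
  have "(lap x v)\<^sup>2 \<le> form x x * form (row v) (row v)"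
    unfolding form_row[OF assms, of x, symmetric] form_def
    using Cauchy_Schwarz_ineq_sum[of x "row v" V] by (simp add: power2_eq_square)
  also have "\<dots> \<le> form x x * ((real (card V))\<^sup>2 + real (card V))"
    unfolding form_row_row[OF assms] using deg_le_card[of v]
    by (intro mult_left_mono add_mono power_mono) (auto simp: form_def sum_nonneg)
  finally show ?thesis by (simp add: mult.commute)
qed

text \<open>The Laplacian embeds the lattice into the integer vectors on \<open>V\<close>, and its
  squared length is at most C times the form. A product of one-dimensional Gaussian series is then a
  majorant.\<close>

lemma lattice_gauss_summable:
  assumes a: "a > 0"
  shows "(\<lambda>x. exp (- a * form x x)) summable_on lattice"
proof -
  define C where "C = real (card V) * ((real (card V))\<^sup>2 + real (card V))"
  have C: "C > 0"
    unfolding C_def using card_V_pos by (intro mult_pos_pos add_pos_pos) auto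
  define b where "b = a / C"
  have b: "b > 0" using a C by (simp add: b_def)
  define z :: "('v \<Rightarrow> real) \<Rightarrow> 'v \<Rightarrow> int" where "z x = (\<lambda>v\<in>V. \<lfloor>lap x v\<rfloor>)" for x
  have z: "of_int (z x v) = lap x v" if "x \<in> lattice" "v \<in> V" for x v
    using that by (auto simp: z_def lattice_def elim!: Ints_cases)
  have inj: "inj_on z lattice"
  proof (rule inj_onI)
    fix x y assume xy: "x \<in> lattice" "y \<in> lattice" "z x = z y"
    have eq: "lap x v = lap y v" if "v \<in> V" for v
      using z[OF xy(1) that] z[OF xy(2) that] xy(3) by simp
    have "(\<lambda>v. x v - y v) = 0"
    proof (rule lattice_eq_0)
      show "(\<lambda>v. x v - y v) \<in> lattice"
        using xy by (auto simp: lattice_def lap_diff sum_subtractf)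
    qed (use eq in \<open>simp add: lap_diff\<close>)
    then show "x = y" by (simp add: fun_eq_iff)
  qed
  let ?f = "\<lambda>g :: 'v \<Rightarrow> int. \<Prod>v\<in>V. exp (- b * (of_int (g v))\<^sup>2)"
  have "?f summable_on (PiE V (\<lambda>_. UNIV))"
    by (intro summable_on_prod_PiE exp_square_int_summable b) auto
  then have "?f summable_on (z ` lattice)"
    by (rule summable_on_subset) (auto simp: z_def)
  then have "(?f \<circ> z) summable_on lattice"
    by (subst (asm) summable_on_reindex[OF inj])
  then show ?thesis
  proof (rule summable_on_comparison_test)
    fix x assume x: "x \<in> lattice"
    have "(\<Sum>v\<in>V. (lap x v)\<^sup>2) \<le> C * form x x"
      using sum_bounded_above[of V "\<lambda>v. (lap x v)\<^sup>2", OF lap_square_le] by (simp add: C_def mult.assoc)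
    then have "b * (\<Sum>v\<in>V. (lap x v)\<^sup>2) \<le> a * form x x"
      using C a by (simp add: b_def field_simps)
    then have "exp (- a * form x x) \<le> exp (- b * (\<Sum>v\<in>V. (lap x v)\<^sup>2))" by simp
    also have "\<dots> = (?f \<circ> z) x"
      using z[OF x] by (simp add: exp_sum[symmetric] sum_distrib_left sum_negf)
    finally show "exp (- a * form x x) \<le> (?f \<circ> z) x" .
  qed simp
qed

lemma gaussian_lattice: "gaussian_lattice lattice form"
proof
  show "0 \<in> lattice" using lap_const[of 0] by (simp add: lattice_def zero_fun_def)
  show "x - y \<in> lattice" if "x \<in> lattice" "y \<in> lattice" for x y
    using that by (auto simp: lattice_def fun_diff_def lap_diff sum_subtractf)
  show "form (x + y) z = form x z + form y z" for x y z
    by (simp add: form_def sum.distrib distrib_right)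
  show "form x y = form y x" for x y by (simp add: form_def mult.commute)
  show "form x x > 0" if "x \<in> lattice" "x \<noteq> 0" for x
  proof -
    obtain v where v: "x v \<noteq> 0" using \<open>x \<noteq> 0\<close> by (auto simp: fun_eq_iff)
    then have "v \<in> V" using that by (auto simp: lattice_def)
    with v show ?thesis
      unfolding form_def by (intro sum_pos2[of _ v]) (auto simp: zero_less_mult_iff)
  qed
qed (rule lattice_gauss_summable)

text \<open>Off the sink, a vertex of degree 0 would contradict the strict inequality for the
  weights. An isolated sink would make the indicator of \<open>W\<close> harmonic on
  \<open>W\<close>, against injectivity.\<close>

lemma deg_pos:
  assumes "card V \<ge> 2" "v \<in> V"
  shows "deg G v > 0"
proof (cases "v = s")
  case False
  obtain \<phi> :: "'v \<Rightarrow> nat" where "\<And>v. v \<in> W \<Longrightarrow> (\<Sum>u\<in>nbs v. \<phi> u) < deg G v * \<phi> v"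
    using superharmonic_weights by metis
  from this[of v] show ?thesis using assms(2) False by (cases "deg G v") auto
next
  case True
  show ?thesis
  proof (rule ccontr)
    assume "\<not> deg G v > 0"
    then have empty: "nbs s = {}" using True by (simp add: deg_eq)
    have "card W > 0" using assms(1) sink by simp
    then obtain w where w: "w \<in> W" by (metis card_gt_0_iff ex_in_conv)
    have "1 - pt s w = 0"
    proof (rule lap_eq_0_imp[of "\<lambda>v. 1 - pt s v" w])
      fix u assume u: "u \<in> W"
      then have "s \<notin> nbs u" using empty nbs_sym[of s u] sink by blast
      then show "lap (\<lambda>v. 1 - pt s v) u = 0" using u by (simp add: lap_diff lap_const lap_pt)
    qed (use w in auto)
    then show False using w by simp
  qed
qed

text \<open>Some vertex m carries the last entry of the sorted sequence. Removing that single copy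
  leaves the degrees of all other vertices at positions up to card V - 2, even if the maximum is
  attained repeatedly.\<close>

lemma second_degree_bound:
  obtains m where "m \<in> V" "\<And>v. v \<in> V \<Longrightarrow> v \<noteq> m \<Longrightarrow> deg G v \<le> second_degree G"
proof -
  define xs where "xs = degree_sequence G"
  have mset: "mset xs = image_mset (deg G) (mset_set V)"
    by (simp add: xs_def degree_sequence_def)
  have sorted: "sorted xs" by (simp add: xs_def degree_sequence_def)
  have len: "length xs = card V"
    using arg_cong[OF mset, of size] by simp
  have ne: "xs \<noteq> []" using len card_V_pos by auto
  have "last xs \<in># mset xs" using ne by simp
  then obtain m where m: "m \<in> V" "deg G m = last xs"
    unfolding mset by auto
  have "deg G v \<le> second_degree G" if v: "v \<in> V" "v \<noteq> m" for v
  proof -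
    have "mset_set V = add_mset m (mset_set (V - {m}))"
      using m(1) by (metis finite_V mset_set.remove)
    moreover have "mset xs = add_mset (last xs) (mset (butlast xs))"
      using ne by (metis append_butlast_last_id mset.simps mset_append union_mset_add_mset_right add.right_neutral)
    ultimately have "mset (butlast xs) = image_mset (deg G) (mset_set (V - {m}))"
      using mset m(2) by simp
    then have "deg G v \<in> set (butlast xs)"
      using v by (metis Diff_iff finite_Diff finite_V finite_set_mset_mset_set image_eqI set_image_mset set_mset_mset singletonD)
    then obtain i where i: "i < length xs - 1" "deg G v = xs ! i"
      by (metis in_set_conv_nth length_butlast nth_butlast)
    have "xs ! i \<le> xs ! (card V - 2)"
      using sorted i len by (intro sorted_nth_mono) auto
    then show ?thesis using i by (simp add: second_degree_def xs_def)
  qed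
  with m(1) show ?thesis using that by blast
qed

text \<open>The test vectors are all rows except that of the exceptional vertex m, whose degree may
  exceed \<open>second_degree\<close>. The remaining n - 1 rows still detect every nonzero lattice
  point.\<close>

lemma lattice_sum_le:
  assumes n: "card V \<ge> 2" and a: "a > 0"
    and L: "\<And>d. d \<le> second_degree G \<Longrightarrow> ((real d)\<^sup>2 + real d) * L \<le> a"
    and small: "2 * (real (card V) - 1) * exp (- L) < 1"
  shows "infsum (\<lambda>x. exp (- a * form x x)) (lattice - {0}) \<le>
    2 * (real (card V) - 1) * exp (- L) / (1 - 2 * (real (card V) - 1) * exp (- L))"
proof -
  interpret gaussian_lattice lattice form by (rule gaussian_lattice)
  obtain m where m: "m \<in> V" "\<And>v. v \<in> V \<Longrightarrow> v \<noteq> m \<Longrightarrow> deg G v \<le> second_degree G"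
    using second_degree_bound by metis
  have card: "real (card (V - {m})) = real (card V) - 1"
    using m(1) n by (simp add: of_nat_diff)
  have D: "form (row v) (row v) > 0" if "v \<in> V" for v
    using deg_pos[OF n that] by (simp add: form_row_row[OF that] add_pos_pos)
  show ?thesis
    unfolding card[symmetric]
  proof (rule infsum_gauss_nonzero_le)
    show "row v \<in> lattice" if "v \<in> V - {m}" for v using that row_mem by simp
    show "row v \<noteq> 0" if "v \<in> V - {m}" for v using that D[of v] by (auto simp: form_def)
    show "form x (row v) \<in> \<int>" if "v \<in> V - {m}" "x \<in> lattice" for v x
      using that by (simp add: form_row lattice_def)
    show "\<exists>v\<in>V - {m}. form x (row v) \<noteq> 0" if x: "x \<in> lattice" "x \<noteq> 0" for x
    proof (rule ccontr)
      assume "\<not> ?thesis"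
      then have *: "lap x v = 0" if "v \<in> V - {m}" for v using that form_row by force
      \<comment> \<open>The values of a Laplacian sum to zero, so the value at the omitted vertex
        vanishes along with the others.\<close>
      have "(\<Sum>v\<in>V. lap x v) = lap x m + (\<Sum>v\<in>V - {m}. lap x v)"
        using m(1) by (intro sum.remove) auto
      then have "lap x m = 0" using * by (simp add: sum_lap)
      then show False using * lattice_eq_0[OF x(1)] x(2) by (metis Diff_iff singletonD)
    qed
    show "exp (- a / form (row v) (row v)) \<le> exp (- L)" if v: "v \<in> V - {m}" for v
    proof -
      have "form (row v) (row v) * L \<le> a"
        using L[OF m(2)[of v]] v by (simp add: form_row_row)
      then show ?thesis using D[of v] v by (simp add: field_simps)
    qed
    show "2 * real (card (V - {m})) * exp (- L) < 1" using small unfolding card .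
  qed (use a in auto)
qed

text \<open>The point assigned to an eigenvalue lives on the hyperplane orthogonal to the constants,
  because only the modulus of the eigenvalue enters.\<close>

lemma eigenvalue_lattice_point:
  assumes "h \<in> group"
  obtains x c k where "x \<in> lattice" "\<And>v. v \<in> V \<Longrightarrow> x v = pot (rl h) v - c - k v" "\<And>v. k v \<in> \<int>"
    "8 * form x x \<le> real (card V) * (1 - cmod (ev h))"
proof -
  obtain c k where k: "\<And>v. k v \<in> \<int>"
    and le: "8 * (\<Sum>v\<in>V. (pot (rl h) v - c - k v)\<^sup>2) \<le> real (card V) - cmod (\<Sum>v\<in>V. cis (2 * pi * pot (rl h) v))"
    using norm_sum_cis_le[OF finite_V, of "pot (rl h)"] by blast
  let ?y = "\<lambda>v. pot (rl h) v - c - k v"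
  define m where "m = (\<Sum>v\<in>V. ?y v) / real (card V)"
  define x where "x v = (if v \<in> V then ?y v - m else 0)" for v
  have V: "V \<noteq> {}" using sink by blast
  note mean = sum_mean_deviation_le[OF finite_V V, of ?y, folded m_def]
  show ?thesis
  proof
    show "x v = pot (rl h) v - (c + m) - k v" if "v \<in> V" for v using that by (simp add: x_def)
    show "k v \<in> \<int>" for v by (rule k)
    have "form x x = (\<Sum>v\<in>V. (?y v - m)\<^sup>2)" by (simp add: form_def x_def power2_eq_square)
    also have "\<dots> \<le> (\<Sum>v\<in>V. (?y v)\<^sup>2)" by (rule mean(2))
    finally have "8 * form x x \<le> real (card V) - cmod (\<Sum>v\<in>V. cis (2 * pi * pot (rl h) v))"
      using le by simp
    also have "\<dots> = real (card V) * (1 - cmod (ev h))"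
      using card_V_pos V by (simp add: ev_def norm_divide right_diff_distrib)
    finally show "8 * form x x \<le> real (card V) * (1 - cmod (ev h))" .
    have lap_x: "lap x v = lap (pot (rl h)) v - lap k v" if "v \<in> V" for v
    proof -
      have "lap x v = lap (\<lambda>v. ?y v - m) v" using that by (intro lap_cong) (auto simp: x_def)
      then show ?thesis by (simp add: lap_diff lap_const)
    qed
    \<comment> \<open>At the sink the Laplacian of the potential is not prescribed; it is minus the
      sum of the integer values elsewhere.\<close>
    have "lap (pot (rl h)) v \<in> \<int>" if v: "v \<in> V" for v
    proof (cases "v = s")
      case True
      have "lap (pot (rl h)) s = - (\<Sum>v\<in>W. lap (pot (rl h)) v)"
        using sum_lap[of "pot (rl h)"] sum.remove[OF finite_V sink, of "lap (pot (rl h))"] by simp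
      also have "\<dots> = - (\<Sum>v\<in>W. real (h v))" using lap_pot by simp
      finally show ?thesis using True by (simp add: Ints_sum)
    next
      case False
      then show ?thesis using v lap_pot[of v "rl h"] by simp
    qed
    then have "lap x v \<in> \<int>" if "v \<in> V" for v using that lap_x k by (simp add: lap_Ints)
    moreover have "(\<Sum>v\<in>V. x v) = 0" using mean(1) by (simp add: x_def)
    ultimately show "x \<in> lattice" by (simp add: lattice_def x_def)
  qed
qed

text \<open>Potentials vanish at the sink, so comparison there shows that c - c' is an integer. The
  potentials then differ by integers on all of \<open>V\<close>, which puts g and h in one
  class.\<close>

lemma shifted_pot_eq_imp:
  assumes "g \<in> group" "h \<in> group" "\<And>v. k v \<in> \<int>" "\<And>v. k' v \<in> \<int>"
    and "\<And>v. v \<in> V \<Longrightarrow> pot (rl g) v - c - k v = pot (rl h) v - c' - k' v"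
  shows "g = h"
proof (rule class_rep_unique[OF assms(1,2) sim_if_pot_Ints])
  fix v assume v: "v \<in> V"
  have "c - c' = k' s - k s" using assms(5)[OF sink] by (simp add: pot_sink)
  then have "pot (rl g) v - pot (rl h) v = (k' s - k s) + (k v - k' v)"
    using assms(5)[OF v] by simp
  then show "pot (rl g) v - pot (rl h) v \<in> \<int>" using assms(3,4) by simp
qed

text \<open>Distinct nontrivial characters give distinct nonzero lattice points, so their finite sum
  is part of a Gaussian sum of positive terms. The parameter arises from 2 t (1 - |ev h|) >= 2 t * 8
  \<open>form\<close> / n.\<close>

lemma sum_eigenvalues_le:
  assumes n: "card V \<ge> 2" and a: "t > 0"
    and bound: "\<And>h. h \<in> group \<Longrightarrow> (f h)\<^sup>2 \<le> exp (- 2 * t * (1 - cmod (ev h)))"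
  shows "(\<Sum>h\<in>group - {sandpile_id G s}. (f h)\<^sup>2) \<le>
    infsum (\<lambda>x. exp (- (16 * t / real (card V)) * form x x)) (lattice - {0})"
proof -
  let ?a = "16 * t / real (card V)" and ?e = "sandpile_id G s"
  have npos: "real (card V) > 0" using n by simp
  obtain X c k where X: "\<And>h. h \<in> group \<Longrightarrow> X h \<in> lattice"
    "\<And>h v. h \<in> group \<Longrightarrow> v \<in> V \<Longrightarrow> X h v = pot (rl h) v - c h - k h v"
    "\<And>h v. h \<in> group \<Longrightarrow> k h v \<in> \<int>"
    "\<And>h. h \<in> group \<Longrightarrow> 8 * form (X h) (X h) \<le> real (card V) * (1 - cmod (ev h))"
  proof -
    have "\<forall>h\<in>group. \<exists>x c k. x \<in> lattice \<and> (\<forall>v\<in>V. x v = pot (rl h) v - c - k v) \<and>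
        (\<forall>v. k v \<in> \<int>) \<and> 8 * form x x \<le> real (card V) * (1 - cmod (ev h))"
      by (intro ballI, rule eigenvalue_lattice_point) blast+
    then show ?thesis using that by metis
  qed
  have inj: "inj_on X group"
  proof (rule inj_onI)
    fix g h assume gh: "g \<in> group" "h \<in> group" "X g = X h"
    show "g = h"
      by (rule shifted_pot_eq_imp[of g h "k g" "k h" "c g" "c h"]) (use gh X(2,3) in \<open>auto simp flip: X(2)\<close>)
  qed
  have nonzero: "X h \<noteq> 0" if h: "h \<in> group - {?e}" for h
  proof
    assume "X h = 0"
    moreover have "pot (rl ?e) v \<in> \<int>" if "v \<in> V" for v
    proof (cases "v = s")
      case False
      then have "cis (2 * pi * pot (rl ?e) v) = 1"
        using chi_id(2)[of "pt v"] chi_pt[of v "rl ?e"] that by simp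
      then show ?thesis by (rule cis_2pi_eq_1_imp_Ints)
    qed (simp add: pot_sink)
    \<comment> \<open>The identity also admits the point 0: its potential is integral on
      \<open>V\<close> and serves as its own integer part, with constant 0.\<close>
    ultimately have "h = ?e"
      using h sandpile_id_mem X(2)[of h] X(3)[of h]
      by (intro shifted_pot_eq_imp[of h ?e "k h" "\<lambda>v. if v \<in> V then pot (rl ?e) v else 0" "c h" 0]) auto
    then show False using h by simp
  qed
  have "(\<Sum>h\<in>group - {?e}. (f h)\<^sup>2) \<le> (\<Sum>h\<in>group - {?e}. exp (- ?a * form (X h) (X h)))"
  proof (rule sum_mono)
    fix h assume h: "h \<in> group - {?e}"
    have "8 * form (X h) (X h) / real (card V) \<le> 1 - cmod (ev h)"
      using X(4)[of h] h npos by (simp add: pos_divide_le_eq mult.commute del: of_nat_0_less_iff)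
    then have "16 * form (X h) (X h) / real (card V) \<le> 2 * (1 - cmod (ev h))"
      by (simp add: field_simps)
    then have "t * (16 * form (X h) (X h) / real (card V)) \<le> t * (2 * (1 - cmod (ev h)))"
      using a by (intro mult_left_mono) auto
    then have "exp (- 2 * t * (1 - cmod (ev h))) \<le> exp (- ?a * form (X h) (X h))"
      by (simp add: mult_ac)
    then show "(f h)\<^sup>2 \<le> exp (- ?a * form (X h) (X h))"
      using bound[of h] h by (meson DiffD1 order_trans)
  qed
  also have "\<dots> = sum (\<lambda>x. exp (- ?a * form x x)) (X ` (group - {?e}))"
    using inj by (subst sum.reindex) (auto intro: inj_on_subset)
  also have "\<dots> \<le> infsum (\<lambda>x. exp (- ?a * form x x)) (lattice - {0})"
  proof (rule finite_sum_le_infsum)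
    show "(\<lambda>x. exp (- ?a * form x x)) summable_on (lattice - {0})"
      by (rule summable_on_subset[OF lattice_gauss_summable]) (use a npos in auto)
    show "finite (X ` (group - {?e}))" using finite_group by simp
    show "X ` (group - {?e}) \<subseteq> lattice - {0}" using X(1) nonzero by auto
  qed simp
  finally show ?thesis .
qed

text \<open>With L the logarithm in the threshold, delta = 2 (n - 1) exp (- L) equals epsilon / (1 +
  epsilon), so delta / (1 - delta) is exactly epsilon.\<close>

lemma sum_eigenvalues_le_epsilon:
  fixes \<epsilon> t :: real
  defines "d \<equiv> real (second_degree G)" and "n \<equiv> real (card V)"
  assumes card: "card V \<ge> 2" and \<epsilon>: "\<epsilon> > 0"
    and t: "t \<ge> 1 / 16 * (d\<^sup>2 + d) * n * ln (2 * (n - 1) * (1 + 1 / \<epsilon>))"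
    and bound: "\<And>h. h \<in> group \<Longrightarrow> (f h)\<^sup>2 \<le> exp (- 2 * t * (1 - cmod (ev h)))"
  shows "(\<Sum>h\<in>group - {sandpile_id G s}. (f h)\<^sup>2) \<le> \<epsilon>"
proof -
  define y where "y = 2 * (n - 1) * (1 + 1 / \<epsilon>)"
  define L where "L = ln y"
  have n: "n \<ge> 2" using card by (simp add: n_def)
  have y: "y > 2"
  proof -
    have "2 * 1 < 2 * (n - 1) * (1 + 1 / \<epsilon>)"
      using n \<epsilon> by (intro mult_le_less_imp_less) auto
    then show ?thesis by (simp add: y_def)
  qed
  have L: "L > 0" using y by (simp add: L_def)
  have expL: "2 * (n - 1) * exp (- L) = \<epsilon> / (1 + \<epsilon>)"
    using y n \<epsilon> by (simp add: L_def exp_minus y_def field_simps)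
  have d: "d \<ge> 1"
  proof -
    obtain m where m: "m \<in> V" "\<And>v. v \<in> V \<Longrightarrow> v \<noteq> m \<Longrightarrow> deg G v \<le> second_degree G"
      using second_degree_bound by metis
    have "card (V - {m}) > 0" using card m(1) by simp
    then obtain v where v: "v \<in> V - {m}" by (metis card_gt_0_iff ex_in_conv)
    then have "0 < deg G v" using deg_pos[OF card] by simp
    also have "\<dots> \<le> second_degree G" using m(2)[of v] v by simp
    finally show ?thesis by (simp add: d_def)
  qed
  have tL: "(d\<^sup>2 + d) * L \<le> 16 * t / n"
    using t n unfolding y_def[symmetric] L_def[symmetric] by (simp add: field_simps)
  have "(d\<^sup>2 + d) * L > 0" using d L by (intro mult_pos_pos add_pos_pos) auto
  then have a: "16 * t / n > 0" using tL by linarith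
  then have t0: "t > 0" using n by (simp add: zero_less_divide_iff)
  have "(\<Sum>h\<in>group - {sandpile_id G s}. (f h)\<^sup>2) \<le>
      infsum (\<lambda>x. exp (- (16 * t / n) * form x x)) (lattice - {0})"
    unfolding n_def by (rule sum_eigenvalues_le[OF card t0 bound])
  also have "\<dots> \<le> 2 * (n - 1) * exp (- L) / (1 - 2 * (n - 1) * exp (- L))"
    unfolding n_def
  proof (rule lattice_sum_le[OF card])
    show "16 * t / real (card V) > 0" using a unfolding n_def .
    show "((real e)\<^sup>2 + real e) * L \<le> 16 * t / real (card V)" if "e \<le> second_degree G" for e
    proof -
      have "((real e)\<^sup>2 + real e) * L \<le> (d\<^sup>2 + d) * L"
        using that L by (intro mult_right_mono add_mono power_mono) (auto simp: d_def)
      then show ?thesis using tL unfolding n_def by simp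
    qed
    show "2 * (real (card V) - 1) * exp (- L) < 1"
      using expL \<epsilon> unfolding n_def by simp
  qed
  also have "\<dots> = \<epsilon>" unfolding expL using \<epsilon> by (simp add: field_simps)
  finally show ?thesis .
qed

text \<open>Both chains reduce to one summand bound: Re z <= |z| in continuous time, and r <= exp (r
  - 1) with r = |ev h| in discrete time.\<close>

lemma mixing:
  fixes \<epsilon> :: real
  defines "d \<equiv> real (second_degree G)" and "n \<equiv> real (card V)"
  defines "T \<equiv> 1 / 16 * (d\<^sup>2 + d) * n * ln (2 * (n - 1) * (1 + 1 / \<epsilon>))"
  assumes card: "card V \<ge> 2" and \<epsilon>: "\<epsilon> > 0"
  shows "t \<ge> T \<Longrightarrow> (L2_dist group (continuous_dist G s t) (uniform_on group))\<^sup>2 \<le> \<epsilon>"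
    and "real k \<ge> T \<Longrightarrow> (L2_dist group (discrete_dist G s k) (uniform_on group))\<^sup>2 \<le> \<epsilon>"
proof -
  assume t: "t \<ge> T"
  show "(L2_dist group (continuous_dist G s t) (uniform_on group))\<^sup>2 \<le> \<epsilon>"
    unfolding L2_dist_continuous
  proof (rule sum_eigenvalues_le_epsilon[OF card \<epsilon>])
    show "t \<ge> 1 / 16 * ((real (second_degree G))\<^sup>2 + real (second_degree G)) * real (card V) *
        ln (2 * (real (card V) - 1) * (1 + 1 / \<epsilon>))"
      using t unfolding T_def d_def n_def .
    \<comment> \<open>Nonnegative time is needed to multiply the comparison of real part and modulus
      by t.\<close>
    have "T \<ge> 0"
    proof -
      have "1 * 1 \<le> (2 * (n - 1)) * (1 + 1 / \<epsilon>)"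
        using card \<epsilon> by (intro mult_mono) (auto simp: n_def)
      then show ?thesis by (simp add: T_def d_def n_def)
    qed
    then have t0: "t \<ge> 0" using t by simp
    fix h
    have "t * (1 - Re (ev h)) \<ge> t * (1 - cmod (ev h))"
      using t0 complex_Re_le_cmod[of "ev h"] by (intro mult_left_mono) auto
    then show "(cmod (exp (- complex_of_real t * (1 - ev h))))\<^sup>2 \<le> exp (- 2 * t * (1 - cmod (ev h)))"
      by (simp add: exp_of_nat_mult[symmetric])
  qed
next
  assume t: "real k \<ge> T"
  show "(L2_dist group (discrete_dist G s k) (uniform_on group))\<^sup>2 \<le> \<epsilon>"
    unfolding L2_dist_discrete
  proof (rule sum_eigenvalues_le_epsilon[OF card \<epsilon>])
    show "real k \<ge> 1 / 16 * ((real (second_degree G))\<^sup>2 + real (second_degree G)) * real (card V) *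
        ln (2 * (real (card V) - 1) * (1 + 1 / \<epsilon>))"
      using t unfolding T_def d_def n_def .
    fix h
    have "cmod (ev h) \<le> exp (- (1 - cmod (ev h)))"
      using exp_ge_add_one_self[of "- (1 - cmod (ev h))"] by simp
    then have "cmod (ev h) ^ (2 * k) \<le> exp (- (1 - cmod (ev h))) ^ (2 * k)"
      by (intro power_mono) auto
    also have "\<dots> = exp (- 2 * real k * (1 - cmod (ev h)))"
      by (simp add: exp_of_nat_mult[symmetric] algebra_simps)
    finally show "(cmod (ev h ^ k))\<^sup>2 \<le> exp (- 2 * real k * (1 - cmod (ev h)))"
      by (simp add: norm_power power_mult[symmetric] mult.commute)
  qed
qed

text \<open>A cycle contains an arc, whose ends differ. Two vertices are what
  \<open>second_degree\<close> presupposes.\<close>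

lemma card_ge_2_if_not_tree:
  assumes "\<not> is_tree G"
  shows "card V \<ge> 2"
proof -
  obtain p where p: "cycle p" "3 \<le> length p"
    using assms conn by (auto simp: is_tree_def)
  then obtain e where e: "e \<in> parcs G" by (cases p) (auto simp: cycle_def awalk_def)
  have "card {fst e, snd e} \<le> card V"
    using e arc_fst_in_verts arc_snd_in_verts by (intro card_mono) auto
  moreover have "fst e \<noteq> snd e" using e by (rule pair_no_loops)
  ultimately show ?thesis by simp
qed

end

theorem theorem4p3:
  fixes G :: "'v pair_pre_digraph" and s :: 'v and \<epsilon> :: real
  defines "n \<equiv> card (pverts G)"
    and "d \<equiv> second_degree G"
    and "U \<equiv> uniform_on (sandpile_group G s)"
  assumes "pair_graph G"
    and "Digraph_Component.connected (with_proj G)"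
    and "\<not> is_tree G"
    and "s \<in> pverts G"
    and "\<epsilon> > 0"
  defines "T \<equiv> 1 / 16 * ((real d)\<^sup>2 + real d) * real n * ln (2 * (real n - 1) * (1 + 1 / \<epsilon>))"
  shows "(\<forall>t::real. t \<ge> T \<longrightarrow> (L2_dist (sandpile_group G s) (continuous_dist G s t) U)\<^sup>2 \<le> \<epsilon>) \<and>
         (\<forall>t::nat. real t \<ge> T \<longrightarrow> (L2_dist (sandpile_group G s) (discrete_dist G s t) U)\<^sup>2 \<le> \<epsilon>)"
proof -
  interpret pair_graph G by (rule assms(4))
  interpret sandpile G s by unfold_locales (use assms in auto)
  show ?thesis
    using mixing[OF card_ge_2_if_not_tree[OF assms(6)] assms(8)]
    unfolding T_def d_def n_def U_def by blast
qed

end
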